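(* Let $\Gamma$ be a residually finite (discrete) group and let $\mathbb{U}$ be the universal Urysohn metric space. Then the homomorphisms $\Gamma\to\mathrm{Iso}(\mathbb{U})$ with finite range (i.e. finite image) are everywhere dense in the space $\mathrm{Rep}(\Gamma,\mathbb{U})$ of all homomorphisms $\Gamma\to\mathrm{Iso}(\mathbb{U})$. In other words, every representation of $\Gamma$ by isometries of $\mathbb{U}$ is approximated by representations with a finite range.
   Context: A group $\Gamma$ is residually finite if it admits a separating family of homomorphisms to finite groups, equivalently if the intersection of all its subgroups of finite index is trivial. The universal Urysohn metric space $\mathbb{U}$ is characterized, up to isometry, by: (1) $\mathbb{U}$ is a complete separable metric space; (2) $\mathbb{U}$ contains an isometric copy of every separable metric space; (3) every isometry between two finite metric subspaces of $\mathbb{U}$ extends to a global isometry of $\mathbb{U}$ onto itself. For a metric space $X$, $\mathrm{Iso}(X)$ is the group of all isometries of $X$ onto itself, with the topology of pointwise convergence on $X$. For a topological group $G$ and a discrete group $\Gamma$, $\mathrm{Rep}(\Gamma,G)$ is the set of all group homomorphisms $\Gamma\to G$ considered as a subspace of $G^{\Gamma}$ with the product topology; $\mathrm{Rep}(\Gamma,X)$ denotes $\mathrm{Rep}(\Gamma,\mathrm{Iso}(X))$, and its elements are called representations of $\Gamma$ by isometries of $X$. *)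

theory Defs
  imports "HOL-Analysis.Analysis" "HOL-Algebra.Bij" "HOL-Algebra.Coset"
begin

definition residually_finite :: "('g, 'b) monoid_scheme \<Rightarrow> bool" where
  "residually_finite G \<longleftrightarrow>
     group G \<and> carrier G \<inter> \<Inter>{H. subgroup H G \<and> finite (rcosets\<^bsub>G\<^esub> H)} = {\<one>\<^bsub>G\<^esub>}"

definition isometric_embedding :: "'a metric \<Rightarrow> 'b metric \<Rightarrow> ('a \<Rightarrow> 'b) \<Rightarrow> bool" where
  "isometric_embedding X Y f \<longleftrightarrow> f \<in> mspace X \<rightarrow> mspace Y \<and>
     (\<forall>x\<in>mspace X. \<forall>y\<in>mspace X. mdist Y (f x) (f y) = mdist X x y)"

definition isometry :: "'a metric \<Rightarrow> 'b metric \<Rightarrow> ('a \<Rightarrow> 'b) \<Rightarrow> bool" where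
  "isometry X Y f \<longleftrightarrow> isometric_embedding X Y f \<and> f ` mspace X = mspace Y"

text \<open>As in \<^const>\<open>BijGroup\<close>, self-maps of \<^term>\<open>mspace X\<close> are represented by extensional functions.\<close>

definition Iso :: "'a metric \<Rightarrow> ('a \<Rightarrow> 'a) monoid" where
  "Iso X = BijGroup (mspace X) \<lparr>carrier := {f \<in> Bij (mspace X). isometry X X f}\<rparr>"

definition Iso_topology :: "'a metric \<Rightarrow> ('a \<Rightarrow> 'a) topology" where
  "Iso_topology X =
     subtopology (product_topology (\<lambda>_. mtopology_of X) (mspace X)) (carrier (Iso X))"

text \<open>\<^const>\<open>hom\<close> does not constrain functions outside the carrier, so homomorphisms are made
  extensional to be points of the product indexed by \<^term>\<open>carrier G\<close>.\<close>

definition Rep :: "('g, 'b) monoid_scheme \<Rightarrow> 'a metric \<Rightarrow> ('g \<Rightarrow> 'a \<Rightarrow> 'a) set" where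
  "Rep G X = hom G (Iso X) \<inter> extensional (carrier G)"

definition Rep_topology :: "('g, 'b) monoid_scheme \<Rightarrow> 'a metric \<Rightarrow> ('g \<Rightarrow> 'a \<Rightarrow> 'a) topology" where
  "Rep_topology G X =
     subtopology (product_topology (\<lambda>_. Iso_topology X) (carrier G)) (Rep G X)"

text \<open>Universality cannot quantify over types. Testing it on metric spaces whose points are reals
  loses nothing, since a separable metric space has at most continuum many points; see
  \<open>urysohn_universal\<close> below.\<close>

definition urysohn_space :: "'a metric \<Rightarrow> bool" where
  "urysohn_space U \<longleftrightarrow>
     mcomplete_of U \<and> separable_space (mtopology_of U) \<and>
     (\<forall>Y :: real metric. separable_space (mtopology_of Y) \<longrightarrow> (\<exists>f. isometric_embedding Y U f)) \<and>
     (\<forall>A B f. finite A \<and> A \<subseteq> mspace U \<and> finite B \<and> B \<subseteq> mspace U \<and>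
        isometry (submetric U A) (submetric U B) f \<longrightarrow>
        (\<exists>g\<in>carrier (Iso U). \<forall>x\<in>A. g x = f x))"

lemma isometry_Bij:
  assumes "isometry X X f" "f \<in> extensional (mspace X)"
  shows "f \<in> Bij (mspace X)"
proof -
  have "inj_on f (mspace X)"
  proof (rule inj_onI)
    fix x y assume xy: "x \<in> mspace X" "y \<in> mspace X" "f x = f y"
    then have "f x \<in> mspace X" "mdist X (f x) (f y) = mdist X x y"
      using assms(1) unfolding isometry_def isometric_embedding_def by (blast dest: Pi_mem)+
    then show "x = y"
      using xy by (metis Metric_space.zero Metric_space_mspace_mdist)
  qed
  then show ?thesis
    using assms unfolding Bij_def isometry_def bij_betw_def by auto
qed

lemma subgroup_Iso: "subgroup (carrier (Iso X)) (BijGroup (mspace X))"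
proof -
  have c: "carrier (Iso X) = {f \<in> Bij (mspace X). isometry X X f}"
    by (simp add: Iso_def)
  show ?thesis
  proof (rule group.subgroupI[OF group_BijGroup])
    show "carrier (Iso X) \<subseteq> carrier (BijGroup (mspace X))"
      by (auto simp: c BijGroup_def)
    have "(\<lambda>x\<in>mspace X. x) \<in> carrier (Iso X)"
      by (auto simp: c id_Bij isometry_def isometric_embedding_def)
    then show "carrier (Iso X) \<noteq> {}" by blast
  next
    fix f assume f: "f \<in> carrier (Iso X)"
    then have fB: "f \<in> Bij (mspace X)"
      and fd: "\<And>x y. x \<in> mspace X \<Longrightarrow> y \<in> mspace X \<Longrightarrow> mdist X (f x) (f y) = mdist X x y"
      by (auto simp: c isometry_def isometric_embedding_def)
    let ?g = "\<lambda>x\<in>mspace X. inv_into (mspace X) f x"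
    have gB: "?g \<in> Bij (mspace X)" by (rule restrict_inv_into_Bij[OF fB])
    have fg: "f (?g x) = x" "?g x \<in> mspace X" if "x \<in> mspace X" for x
      using fB that Bij_imp_funcset[OF gB]
      by (auto simp: Bij_def bij_betw_def f_inv_into_f inv_into_into)
    have "mdist X (?g x) (?g y) = mdist X x y" if "x \<in> mspace X" "y \<in> mspace X" for x y
      using fd[of "?g x" "?g y"] fg that by metis
    moreover have "?g ` mspace X = mspace X" using gB by (simp add: Bij_def bij_betw_def)
    ultimately have "isometry X X ?g"
      using fg by (auto simp: isometry_def isometric_embedding_def)
    then show "inv\<^bsub>BijGroup (mspace X)\<^esub> f \<in> carrier (Iso X)"
      using gB fB by (simp add: inv_BijGroup c)
  next
    fix f g assume fg: "f \<in> carrier (Iso X)" "g \<in> carrier (Iso X)"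
    then have B: "f \<in> Bij (mspace X)" "g \<in> Bij (mspace X)" by (auto simp: c)
    have cB: "compose (mspace X) f g \<in> Bij (mspace X)" by (rule compose_Bij[OF B])
    then have "compose (mspace X) f g ` mspace X = mspace X"
      by (simp add: Bij_def bij_betw_def)
    then have "isometry X X (compose (mspace X) f g)"
      using fg by (auto simp: c isometry_def isometric_embedding_def compose_def Pi_iff)
    then show "f \<otimes>\<^bsub>BijGroup (mspace X)\<^esub> g \<in> carrier (Iso X)"
      using cB B by (simp add: BijGroup_def c)
  qed
qed

lemma group_Iso: "group (Iso X)"
  using subgroup.subgroup_is_group[OF subgroup_Iso group_BijGroup, of X]
  by (simp add: Iso_def)

lemma topspace_Iso_topology: "topspace (Iso_topology X) = carrier (Iso X)"
  by (auto simp: Iso_topology_def Iso_def Bij_def PiE_def isometry_def isometric_embedding_def)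

lemma topspace_Rep_topology: "topspace (Rep_topology G X) = Rep G X"
  by (auto simp: Rep_topology_def Rep_def topspace_Iso_topology PiE_def hom_def)

lemma separable_metric_lepoll_real:
  fixes Y :: "'b metric"
  assumes "separable_space (mtopology_of Y)"
  shows "mspace Y \<lesssim> (UNIV :: real set)"
proof -
  interpret Y: Metric_space "mspace Y" "mdist Y" by simp
  obtain C where C: "countable C" "C \<subseteq> mspace Y" "mtopology_of Y closure_of C = mspace Y"
    using assms by (auto simp: separable_space_def)
  let ?h = "\<lambda>x. {(c, q :: rat). c \<in> C \<and> mdist Y x c < of_rat q}"
  have inj: "inj_on ?h (mspace Y)"
  proof (rule inj_onI, rule ccontr)
    fix x y assume xy: "x \<in> mspace Y" "y \<in> mspace Y" "?h x = ?h y" "x \<noteq> y"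
    let ?e = "mdist Y x y / 2"
    have pos: "?e > 0" using xy by simp
    have "x \<in> mtopology_of Y closure_of C" using C xy by simp
    then obtain c where c: "c \<in> C" "mdist Y x c < ?e"
      using pos unfolding mtopology_of_def Y.metric_closure_of by (fastforce simp: Y.mball_def)
    obtain q where q: "mdist Y x c < of_rat q" "of_rat q < ?e"
      using of_rat_dense[OF c(2)] by blast
    then have "(c, q) \<in> ?h y" using c xy by blast
    then have "mdist Y y c < ?e" using q by auto
    moreover have "mdist Y x y \<le> mdist Y x c + mdist Y y c"
      using Y.triangle[of x c y] xy c C by (auto simp: Y.commute)
    ultimately show False using c by linarith
  qed
  have cnt: "countable (C \<times> (UNIV :: rat set))" using C by simp
  have "?h ` mspace Y \<subseteq> Pow (C \<times> UNIV)" by auto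
  then have 1: "mspace Y \<lesssim> Pow (C \<times> (UNIV :: rat set))"
    using inj unfolding lepoll_def by blast
  have inj2: "inj_on ((`) (to_nat_on (C \<times> (UNIV :: rat set)))) (Pow (C \<times> UNIV))"
    by (rule inj_on_image_Pow[OF inj_on_to_nat_on[OF cnt]])
  then have "Pow (C \<times> (UNIV :: rat set)) \<lesssim> (UNIV :: nat set set)"
    unfolding lepoll_def by blast
  then show ?thesis
    using 1 nat_sets_eqpoll_reals lepoll_trans lepoll_trans2 by blast
qed

lemma urysohn_universal:
  fixes U :: "'a metric" and Y :: "'b metric"
  assumes U: "urysohn_space U" and Y: "separable_space (mtopology_of Y)"
  shows "\<exists>f. isometric_embedding Y U f"
proof -
  interpret Y: Metric_space "mspace Y" "mdist Y" by simp
  obtain h :: "'b \<Rightarrow> real" where h: "inj_on h (mspace Y)"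
    using separable_metric_lepoll_real[OF Y] by (auto simp: lepoll_def)
  define k where "k = inv_into (mspace Y) h"
  define d where "d = (\<lambda>r s. mdist Y (k r) (k s))"
  have kh: "k (h x) = x" if "x \<in> mspace Y" for x
    using h that by (simp add: k_def)
  interpret Z: Metric_space "h ` mspace Y" d
    by unfold_locales (auto simp: d_def kh Y.commute Y.triangle)
  let ?Z = "metric (h ` mspace Y, d)"
  interpret YZ: Metric_space12 "mspace Y" "mdist Y" "h ` mspace Y" d by unfold_locales
  have "homeomorphic_map Y.mtopology Z.mtopology h"
    by (rule YZ.isometry_imp_homeomorphic_map) (auto simp: d_def kh)
  then have "mtopology_of Y homeomorphic_space mtopology_of ?Z"
    by (auto simp: mtopology_of_def homeomorphic_map_imp_homeomorphic_space)
  then have "separable_space (mtopology_of ?Z)"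
    using Y homeomorphic_separable_space by blast
  then obtain f where "isometric_embedding ?Z U f"
    using U unfolding urysohn_space_def by blast
  then have "isometric_embedding Y U (f \<circ> h)"
    by (auto simp: isometric_embedding_def Pi_iff) (simp add: d_def kh)
  then show ?thesis by blast
qed

end

theory Submission
  imports Defs
begin

text \<open>Let \<open>\<rho>\<close> be an action of \<open>G\<close> by isometries of \<open>U\<close>. A basic neighbourhood of \<open>\<rho>\<close> only tests
finitely many group elements \<open>F\<close> on finitely many points \<open>A\<close>, up to an error \<open>e\<close>
(\<open>in_closure_of_Rep_topology\<close>). All that \<open>\<rho>\<close> contributes to the problem is the left-invariant
pseudometric \<open>\<delta> (g, a) (h, b) = dist (\<rho> g a) (\<rho> h b)\<close> on \<open>G \<times> A\<close>. Two facts give the theorem.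

\<^bold>\<open>The pseudometric can be copied to a finite quotient\<close> (\<open>finite_quotient_metric\<close>). There is a normal
subgroup \<open>N\<close> of finite index and a \<open>G/N\<close>-invariant metric on \<open>G/N \<times> A\<close> which equals \<open>\<delta> + e\<close> between any
two distinct points coming from \<open>F \<times> A\<close>. To get it, add \<open>e\<close> to all distances and take the maximum
with \<open>e\<close> times a word length on \<open>G\<close>, truncated at a large \<open>M\<close>. The word metric is taken with
respect to the differences \<open>g\<^sup>-\<^sup>1 h\<close> of elements of \<open>F\<close>, so it changes nothing on \<open>F \<times> A\<close>; but
it puts all but finitely many translates \<open>n h\<close> at least as far from \<open>g\<close> as any two points of \<open>F \<times> A\<close>
are from each other.
Residual finiteness supplies an \<open>N\<close> that avoids the finitely many exceptions, and then passing to
the quotient metric, which minimises over \<open>N\<close>-translates, creates no shortcut within \<open>F \<times> A\<close>.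

\<^bold>\<open>Finite group actions extend to \<open>U\<close>\<close> (\<open>finite_action_extends\<close>). If a finite group acts by isometries on
a finite subset of \<open>U\<close>, the action extends to all of \<open>U\<close>. Points of a countable dense set
are adjoined one after the other, each time embedding the new point together with
a whole orbit of it (\<open>finite_action_adjoin_point\<close>); this exhausts a dense subset, and
the action passes to the completion.

The two are connected by \<open>urysohn_extension\<close>: a finite metric space, part of which already lies in \<open>U\<close>, can
be placed in \<open>U\<close> without moving that part. It puts \<open>G/N \<times> A\<close> into \<open>U\<close> with the class of \<open>(g, a)\<close> at
distance \<open>e / 2\<close> from \<open>\<rho> g a\<close>, where the summand \<open>e\<close> in the new metric is exactly the room needed
(\<open>perturbed_copy\<close>). Extending the translation action of \<open>G/N\<close> and composing with \<open>G \<rightarrow> G/N\<close> yields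
a homomorphism with finite range close to \<open>\<rho>\<close>. The quotient of
\<open>\<delta>\<close> itself would not do: the stabiliser of a point need not be closed in the profinite topology of \<open>G\<close>, and if it
is not, some other point of its \<open>G\<close>-orbit lies in its \<open>N\<close>-orbit for every \<open>N\<close>.\<close>

section \<open>Isometric actions and embeddings into the Urysohn space\<close>

definition isometric_action ::
    "('k, 'm) monoid_scheme \<Rightarrow> ('a \<Rightarrow> 'a \<Rightarrow> real) \<Rightarrow> 'a set \<Rightarrow> ('k \<Rightarrow> 'a \<Rightarrow> 'a) \<Rightarrow> bool" where
  "isometric_action K d Z \<alpha> \<longleftrightarrow>
     (\<forall>k\<in>carrier K. \<alpha> k \<in> Z \<rightarrow> Z) \<and>
     (\<forall>z\<in>Z. \<alpha> \<one>\<^bsub>K\<^esub> z = z) \<and>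
     (\<forall>k\<in>carrier K. \<forall>l\<in>carrier K. \<forall>z\<in>Z. \<alpha> (k \<otimes>\<^bsub>K\<^esub> l) z = \<alpha> k (\<alpha> l z)) \<and>
     (\<forall>k\<in>carrier K. \<forall>z\<in>Z. \<forall>w\<in>Z. d (\<alpha> k z) (\<alpha> k w) = d z w)"

lemma isometric_actionD:
  assumes "isometric_action K d Z \<alpha>"
  shows "\<And>k z. k \<in> carrier K \<Longrightarrow> z \<in> Z \<Longrightarrow> \<alpha> k z \<in> Z"
    and "\<And>z. z \<in> Z \<Longrightarrow> \<alpha> \<one>\<^bsub>K\<^esub> z = z"
    and "\<And>k l z. k \<in> carrier K \<Longrightarrow> l \<in> carrier K \<Longrightarrow> z \<in> Z \<Longrightarrow> \<alpha> (k \<otimes>\<^bsub>K\<^esub> l) z = \<alpha> k (\<alpha> l z)"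
    and "\<And>k z w. k \<in> carrier K \<Longrightarrow> z \<in> Z \<Longrightarrow> w \<in> Z \<Longrightarrow> d (\<alpha> k z) (\<alpha> k w) = d z w"
  using assms unfolding isometric_action_def Pi_iff by blast+

lemma isometric_embedding_inj_on:
  fixes U :: "'u metric"
  assumes "Metric_space M d" "f \<in> M \<rightarrow> mspace U"
    and "\<And>x y. x \<in> M \<Longrightarrow> y \<in> M \<Longrightarrow> mdist U (f x) (f y) = d x y"
  shows "inj_on f M"
proof (rule inj_onI)
  interpret M: Metric_space M d by fact
  fix x y assume xy: "x \<in> M" "y \<in> M" "f x = f y"
  then have "f x \<in> mspace U" using assms by blast
  then have "mdist U (f x) (f y) = 0"
    using xy by (metis Metric_space.mdist_zero Metric_space_mspace_mdist)
  then show "x = y" using assms(3) xy by (metis M.zero)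
qed

text \<open>Actions are constructed on abstract finite metric spaces (quotients of the group, spaces of functions)
and then carried over to the image of such a space in \<open>U\<close>.\<close>

lemma isometric_action_transport:
  fixes U :: "'u metric"
  assumes act: "isometric_action K d M \<alpha>" and M: "Metric_space M d"
    and f: "f \<in> M \<rightarrow> mspace U" and fd: "\<And>x y. x \<in> M \<Longrightarrow> y \<in> M \<Longrightarrow> mdist U (f x) (f y) = d x y"
  obtains \<beta> where "isometric_action K (mdist U) (f ` M) \<beta>"
    "\<And>k x. k \<in> carrier K \<Longrightarrow> x \<in> M \<Longrightarrow> \<beta> k (f x) = f (\<alpha> k x)"
proof
  let ?\<beta> = "\<lambda>k y. f (\<alpha> k (inv_into M f y))"
  note a = isometric_actionD[OF act]
  have inv: "inv_into M f (f x) = x" if "x \<in> M" for x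
    using inv_into_f_f[OF isometric_embedding_inj_on[OF M f fd]] that by blast
  then show "?\<beta> k (f x) = f (\<alpha> k x)" if "k \<in> carrier K" "x \<in> M" for k x
    using that by simp
  show "isometric_action K (mdist U) (f ` M) ?\<beta>"
    unfolding isometric_action_def using a inv fd by auto
qed

lemma finite_imp_separable_space:
  assumes "finite (topspace X)"
  shows "separable_space X"
  unfolding separable_space_def
  by (intro exI[of _ "topspace X"]) (simp add: assms countable_finite)

text \<open>Universality embeds \<open>M\<close> somewhere in \<open>U\<close>; the already placed points then have two congruent
positions in \<open>U\<close>, and homogeneity moves one onto the other. The part that is already placed is
given by a family indexed by \<open>I\<close> rather than by a subset of \<open>M\<close>, so that it may list points repeatedly.\<close>

lemma urysohn_extension:
  fixes U :: "'u metric"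
  assumes U: "urysohn_space U" and M: "Metric_space M d" "finite M"
    and j: "j \<in> I \<rightarrow> M" and \<psi>: "\<psi> \<in> I \<rightarrow> mspace U"
    and eq: "\<And>i i'. i \<in> I \<Longrightarrow> i' \<in> I \<Longrightarrow> mdist U (\<psi> i) (\<psi> i') = d (j i) (j i')"
  obtains f where "f \<in> M \<rightarrow> mspace U"
    and "\<And>x y. x \<in> M \<Longrightarrow> y \<in> M \<Longrightarrow> mdist U (f x) (f y) = d x y"
    and "\<And>i. i \<in> I \<Longrightarrow> f (j i) = \<psi> i"
proof -
  interpret M: Metric_space M d by fact
  interpret U: Metric_space "mspace U" "mdist U" by simp
  have "separable_space (mtopology_of (metric (M, d)))"
    by (rule finite_imp_separable_space) (simp add: M)
  then obtain h where h: "isometric_embedding (metric (M, d)) U h"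
    using urysohn_universal[OF U] by blast
  then have hM: "h x \<in> mspace U" if "x \<in> M" for x
    using that by (auto simp: isometric_embedding_def)
  have hd: "mdist U (h x) (h y) = d x y" if "x \<in> M" "y \<in> M" for x y
    using that h by (auto simp: isometric_embedding_def)
  have jM: "j i \<in> M" if "i \<in> I" for i using j that by (rule Pi_mem)
  have \<psi>U: "\<psi> i \<in> mspace U" if "i \<in> I" for i using \<psi> that by (rule Pi_mem)
  have inj: "h (j i) = h (j i') \<longleftrightarrow> \<psi> i = \<psi> i'" if "i \<in> I" "i' \<in> I" for i i'
    using U.zero[OF hM[OF jM] hM[OF jM]] U.zero[OF \<psi>U \<psi>U] hd[OF jM jM] eq that by metis
  define A where "A = (\<lambda>i. h (j i)) ` I"
  define B where "B = \<psi> ` I"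
  define u where "u = (\<lambda>a. \<psi> (SOME i. i \<in> I \<and> h (j i) = a))"
  have u: "u (h (j i)) = \<psi> i" if "i \<in> I" for i
  proof -
    have "(SOME i'. i' \<in> I \<and> h (j i') = h (j i)) \<in> I \<and> h (j (SOME i'. i' \<in> I \<and> h (j i') = h (j i))) = h (j i)"
      by (rule someI[of _ i]) (use that in auto)
    then show ?thesis unfolding u_def using inj that by blast
  qed
  have "A \<subseteq> h ` M" using jM by (auto simp: A_def)
  then have finA: "finite A" using M(2) finite_subset by blast
  have BA: "B = u ` A" unfolding A_def B_def image_image using u by (intro image_cong) auto
  have AU: "A \<subseteq> mspace U" using hM jM by (auto simp: A_def)
  have BU: "B \<subseteq> mspace U" using \<psi>U by (auto simp: B_def)
  have "isometry (submetric U A) (submetric U B) u"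
    unfolding isometry_def isometric_embedding_def
  proof (intro conjI ballI)
    show "u \<in> mspace (submetric U A) \<rightarrow> mspace (submetric U B)" using BU BA by auto
    show "u ` mspace (submetric U A) = mspace (submetric U B)"
      using AU BU by (simp add: inf.absorb1 inf.absorb2 BA)
    fix a b assume "a \<in> mspace (submetric U A)" "b \<in> mspace (submetric U A)"
    then obtain i i' where "i \<in> I" "i' \<in> I" "a = h (j i)" "b = h (j i')"
      by (auto simp: A_def)
    then show "mdist (submetric U B) (u a) (u b) = mdist (submetric U A) a b"
      by (simp add: u eq hd jM)
  qed
  moreover have "finite B" using finA BA by simp
  moreover have "\<And>A B f. \<lbrakk>finite A; A \<subseteq> mspace U; finite B; B \<subseteq> mspace U;
      isometry (submetric U A) (submetric U B) f\<rbrakk> \<Longrightarrow> \<exists>g\<in>carrier (Iso U). \<forall>x\<in>A. g x = f x"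
    using U unfolding urysohn_space_def by meson
  ultimately obtain g where g: "g \<in> carrier (Iso U)" "\<And>x. x \<in> A \<Longrightarrow> g x = u x"
    using finA AU BU by metis
  then have gi: "isometric_embedding U U g"
    by (simp add: Iso_def isometry_def)
  show thesis
  proof (rule that[of "g \<circ> h"])
    show "g \<circ> h \<in> M \<rightarrow> mspace U" using gi hM by (auto simp: isometric_embedding_def)
    show "mdist U ((g \<circ> h) x) ((g \<circ> h) y) = d x y" if "x \<in> M" "y \<in> M" for x y
      using gi hM hd that by (auto simp: isometric_embedding_def)
    show "(g \<circ> h) (j i) = \<psi> i" if "i \<in> I" for i
      using g(2) u that by (auto simp: A_def)
  qed
qed

section \<open>Adjoining an orbit to a finite action\<close>

text \<open>The element 0 makes the maximum meaningful for empty \<open>Z\<close> and changes nothing otherwise.\<close>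

definition sup_dist :: "'a set \<Rightarrow> ('a \<Rightarrow> real) \<Rightarrow> ('a \<Rightarrow> real) \<Rightarrow> real" where
  "sup_dist Z f g = Max (insert 0 ((\<lambda>z. \<bar>f z - g z\<bar>) ` Z))"

lemma sup_dist_le_iff:
  assumes "finite Z"
  shows "sup_dist Z f g \<le> c \<longleftrightarrow> 0 \<le> c \<and> (\<forall>z\<in>Z. \<bar>f z - g z\<bar> \<le> c)"
  using assms by (auto simp: sup_dist_def)

lemma sup_dist_bounds:
  assumes "finite Z"
  shows "0 \<le> sup_dist Z f g" "z \<in> Z \<Longrightarrow> \<bar>f z - g z\<bar> \<le> sup_dist Z f g"
  using sup_dist_le_iff[OF assms, of f g "sup_dist Z f g"] by auto

lemma Metric_space_sup_dist:
  assumes Z: "finite Z" and M: "M \<subseteq> extensional Z"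
  shows "Metric_space M (sup_dist Z)"
proof
  fix f g h
  show "0 \<le> sup_dist Z f g" using sup_dist_bounds(1)[OF Z] .
  show "sup_dist Z f g = sup_dist Z g f" by (simp add: sup_dist_def abs_minus_commute)
  show "sup_dist Z f g = 0 \<longleftrightarrow> f = g" if "f \<in> M" "g \<in> M"
  proof
    assume 0: "sup_dist Z f g = 0"
    show "f = g"
    proof (rule extensionalityI[of _ Z])
      show "f \<in> extensional Z" "g \<in> extensional Z" using that M by auto
      show "f z = g z" if "z \<in> Z" for z
        using sup_dist_bounds(2)[OF Z that, of f g] 0 by simp
    qed
  next
    assume "f = g" 
    then have "sup_dist Z f g \<le> 0" by (simp add: sup_dist_le_iff[OF Z])
    then show "sup_dist Z f g = 0" using sup_dist_bounds(1)[OF Z, of f g] by simp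
  qed
  have "\<bar>f z - h z\<bar> \<le> sup_dist Z f g + sup_dist Z g h" if "z \<in> Z" for z
    using sup_dist_bounds(2)[OF Z that, of f g] sup_dist_bounds(2)[OF Z that, of g h] by linarith
  then show "sup_dist Z f h \<le> sup_dist Z f g + sup_dist Z g h"
    using sup_dist_bounds(1)[OF Z] by (simp add: sup_dist_le_iff[OF Z] add_nonneg_nonneg)
qed

text \<open>The new orbit is found among the functions on \<open>Z\<close>. By Kuratowski's embedding, \<open>y \<mapsto> dist y \<cdot>\<close> maps
\<open>Z \<union> {x}\<close> isometrically into the functions on \<open>Z\<close> with the supremum metric. On functions, \<open>K\<close> acts by
isometries through translation of the argument, and this action extends the given one on \<open>Z\<close>. Hence the images of
\<open>Z\<close> together with the translates of the image of \<open>x\<close> form a finite metric space with an action of \<open>K\<close>,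
which is embedded back into \<open>U\<close> with \<open>Z \<union> {x}\<close> kept in place. Using the ambient space of functions avoids having
to invent distances between the translates of \<open>x\<close> and to verify the triangle inequality for them.\<close>

lemma finite_action_adjoin_point:
  fixes U :: "'u metric" and K :: "('k, 'm) monoid_scheme"
  assumes U: "urysohn_space U" and K: "group K" "finite (carrier K)"
    and Z: "finite Z" "Z \<subseteq> mspace U" and act: "isometric_action K (mdist U) Z \<alpha>"
    and x: "x \<in> mspace U"
  obtains Z' \<alpha>' where "finite Z'" "Z' \<subseteq> mspace U" "isometric_action K (mdist U) Z' \<alpha>'"
    "insert x Z \<subseteq> Z'" "\<And>k z. k \<in> carrier K \<Longrightarrow> z \<in> Z \<Longrightarrow> \<alpha>' k z = \<alpha> k z"
proof -
  interpret K: group K by fact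
  interpret U: Metric_space "mspace U" "mdist U" by simp
  note a = isometric_actionD[OF act]
  define \<kappa> where "\<kappa> = (\<lambda>y. \<lambda>z\<in>Z. mdist U y z)"
  define act where "act = (\<lambda>k f. \<lambda>z\<in>Z. f (\<alpha> (inv\<^bsub>K\<^esub> k) z) :: real)"
  define M where "M = \<kappa> ` Z \<union> (\<lambda>k. act k (\<kappa> x)) ` carrier K"
  have ext: "M \<subseteq> extensional Z" by (auto simp: M_def \<kappa>_def act_def)
  note M = Metric_space_sup_dist[OF Z(1) ext]
  have finM: "finite M" using Z(1) K(2) by (simp add: M_def)
  have act_one: "act \<one>\<^bsub>K\<^esub> f = f" if "f \<in> extensional Z" for f
    using that a(2) by (auto simp: act_def fun_eq_iff extensional_def)
  have act_mult: "act (k \<otimes>\<^bsub>K\<^esub> l) f = act k (act l f)" if "k \<in> carrier K" "l \<in> carrier K" for k l f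
    using that a(1,3) by (auto simp: act_def fun_eq_iff K.inv_mult_group)
  have inv_act: "\<alpha> (inv\<^bsub>K\<^esub> k) (\<alpha> k z) = z" "\<alpha> k (\<alpha> (inv\<^bsub>K\<^esub> k) z) = z"
    if "k \<in> carrier K" "z \<in> Z" for k z
    using that a(2,3) by (metis K.inv_closed K.l_inv, metis K.inv_closed K.r_inv)
  have act_\<kappa>: "act k (\<kappa> z) = \<kappa> (\<alpha> k z)" if "k \<in> carrier K" "z \<in> Z" for k z
  proof
    fix w
    show "act k (\<kappa> z) w = \<kappa> (\<alpha> k z) w"
    proof (cases "w \<in> Z")
      case True
      then have "mdist U z (\<alpha> (inv\<^bsub>K\<^esub> k) w) = mdist U (\<alpha> k z) w"
        using a(4)[of k z "\<alpha> (inv\<^bsub>K\<^esub> k) w"] that inv_act a(1) by simp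
      then show ?thesis using True that a(1) by (simp add: act_def \<kappa>_def)
    qed (simp add: act_def \<kappa>_def)
  qed
  have actM: "act k f \<in> M" if "k \<in> carrier K" "f \<in> M" for k f
    using that a(1) by (auto simp: M_def act_\<kappa> simp flip: act_mult)
  have act_dist: "sup_dist Z (act k f) (act k g) = sup_dist Z f g" if k: "k \<in> carrier K" for k f g
  proof -
    have "\<alpha> (inv\<^bsub>K\<^esub> k) ` Z = Z"
      using a(1) inv_act k by (force simp: image_iff)
    moreover have "(\<lambda>z. \<bar>act k f z - act k g z\<bar>) ` Z = (\<lambda>z. \<bar>f z - g z\<bar>) ` \<alpha> (inv\<^bsub>K\<^esub> k) ` Z"
      by (auto simp: act_def image_image)
    ultimately show ?thesis by (simp add: sup_dist_def)
  qed
  have actK: "isometric_action K (sup_dist Z) M act"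
    unfolding isometric_action_def
    by (intro conjI ballI Pi_I) (simp_all add: actM act_one act_mult act_dist subsetD[OF ext])
  \<comment> \<open>The supremum is attained at \<open>y\<close> or \<open>y\'\<close>, at least one of which lies in \<open>Z\<close> unless \<open>y = y\'\<close>.\<close>
  have \<kappa>d: "mdist U y y' = sup_dist Z (\<kappa> y) (\<kappa> y')" if "y \<in> insert x Z" "y' \<in> insert x Z" for y y'
  proof (rule antisym)
    have yU: "y \<in> mspace U" "y' \<in> mspace U" using that Z(2) x by auto
    have "\<bar>mdist U y z - mdist U y' z\<bar> \<le> mdist U y y'" if "z \<in> Z" for z
      using U.triangle[of y y' z] U.triangle[of y' y z] that Z(2) yU by (auto simp: U.commute)
    then show "sup_dist Z (\<kappa> y) (\<kappa> y') \<le> mdist U y y'"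
      by (simp add: sup_dist_le_iff[OF Z(1)] \<kappa>_def)
    show "mdist U y y' \<le> sup_dist Z (\<kappa> y) (\<kappa> y')"
    proof -
      have "?thesis" if "y \<in> Z"
        using sup_dist_bounds(2)[OF Z(1) that, of "\<kappa> y" "\<kappa> y'"] that yU
        by (simp add: \<kappa>_def U.commute)
      moreover have "?thesis" if "y' \<in> Z"
        using sup_dist_bounds(2)[OF Z(1) that, of "\<kappa> y" "\<kappa> y'"] that yU
        by (simp add: \<kappa>_def)
      moreover have "?thesis" if "y = y'"
        using sup_dist_bounds(1)[OF Z(1)] that yU by simp
      ultimately show ?thesis using that by blast
    qed
  qed
  have \<kappa>M: "\<kappa> \<in> insert x Z \<rightarrow> M"
  proof -
    have "\<kappa> x = act \<one>\<^bsub>K\<^esub> (\<kappa> x)" by (simp add: act_one \<kappa>_def)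
    then show ?thesis using K.one_closed unfolding M_def by blast
  qed
  have idU: "(\<lambda>y. y) \<in> insert x Z \<rightarrow> mspace U" using Z(2) x by auto
  obtain f where f: "f \<in> M \<rightarrow> mspace U"
    "\<And>p q. p \<in> M \<Longrightarrow> q \<in> M \<Longrightarrow> mdist U (f p) (f q) = sup_dist Z p q"
    "\<And>y. y \<in> insert x Z \<Longrightarrow> f (\<kappa> y) = y"
    by (rule urysohn_extension[OF U M finM \<kappa>M idU]) (simp_all add: \<kappa>d)
  obtain \<beta> where \<beta>: "isometric_action K (mdist U) (f ` M) \<beta>"
    "\<And>k p. k \<in> carrier K \<Longrightarrow> p \<in> M \<Longrightarrow> \<beta> k (f p) = f (act k p)"
    using isometric_action_transport[OF actK M f(1,2)] by blast
  show thesis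
  proof (rule that[OF _ _ \<beta>(1)])
    show "finite (f ` M)" using finM by simp
    show "f ` M \<subseteq> mspace U" using f(1) by auto
    show "insert x Z \<subseteq> f ` M"
    proof
      fix y assume y: "y \<in> insert x Z"
      then have "f (\<kappa> y) \<in> f ` M" using \<kappa>M by blast
      then show "y \<in> f ` M" using f(3) y by simp
    qed
    show "\<beta> k z = \<alpha> k z" if "k \<in> carrier K" "z \<in> Z" for k z
    proof -
      have "\<beta> k (f (\<kappa> z)) = f (\<kappa> (\<alpha> k z))"
        using \<beta>(2)[of k "\<kappa> z"] \<kappa>M that by (simp add: act_\<kappa> Pi_iff)
      then show ?thesis using f(3) that a(1) by simp
    qed
  qed
qed

section \<open>Extending isometries and actions from a dense set\<close>

lemma mdist_less_of_closure:
  assumes "x \<in> mtopology_of X closure_of D" "0 < (e :: real)"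
  obtains y where "y \<in> D" "y \<in> mspace X" "mdist X x y < e"
proof -
  interpret X: Metric_space "mspace X" "mdist X" by simp
  show thesis
    using assms that unfolding mtopology_of_def X.metric_closure_of by (fastforce simp: X.mball_def)
qed

lemma isometric_embedding_eq_on_dense:
  assumes f: "isometric_embedding X Y f" and g: "isometric_embedding X Y g"
    and D: "mtopology_of X closure_of D = mspace X" and eq: "\<And>x. x \<in> D \<Longrightarrow> f x = g x"
    and x: "x \<in> mspace X"
  shows "f x = g x"
proof (rule ccontr)
  interpret Y: Metric_space "mspace Y" "mdist Y" by simp
  assume ne: "f x \<noteq> g x"
  have fgx: "f x \<in> mspace Y" "g x \<in> mspace Y"
    using f g x by (auto simp: isometric_embedding_def)
  then have "0 < mdist Y (f x) (g x) / 2" using ne by simp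
  then obtain y where y: "y \<in> D" "y \<in> mspace X" "mdist X x y < mdist Y (f x) (g x) / 2"
    using mdist_less_of_closure D x by metis
  have "mdist Y (f x) (f y) = mdist X x y" "mdist Y (g x) (g y) = mdist X x y" "f y \<in> mspace Y"
    using f g x y by (auto simp: isometric_embedding_def)
  then show False
    using Y.triangle[of "f x" "f y" "g x"] fgx y eq[OF y(1)] by (simp add: Y.commute)
qed

text \<open>The Lipschitz extension to the closure preserves distances because these are
preserved on the dense set and depend continuously on the points. The Lipschitz constant \<open>C\<close> of
the extension may exceed 1, whence its appearance in the choice of \<open>e\<close>.\<close>

lemma isometric_embedding_extends_from_dense:
  assumes Y: "mcomplete_of Y" and DX: "D \<subseteq> mspace X"
    and D: "mtopology_of X closure_of D = mspace X"
    and f: "f \<in> D \<rightarrow> mspace Y"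
    and fd: "\<And>x y. x \<in> D \<Longrightarrow> y \<in> D \<Longrightarrow> mdist Y (f x) (f y) = mdist X x y"
  obtains g where "isometric_embedding X Y g" "\<And>x. x \<in> D \<Longrightarrow> g x = f x"
proof -
  interpret X: Metric_space "mspace X" "mdist X" by simp
  interpret Y: Metric_space "mspace Y" "mdist Y" by simp
  have "Lipschitz_continuous_map (submetric X D) Y f"
    unfolding Lipschitz_continuous_map_def using f fd by (auto intro!: exI[of _ 1])
  then obtain g where gL: "Lipschitz_continuous_map (submetric X (mspace X)) Y g"
    and gf: "\<And>x. x \<in> D \<Longrightarrow> g x = f x"
    using Lipschitz_continuous_map_extends_to_closure_of[OF Y] D by metis
  have gY: "g x \<in> mspace Y" if "x \<in> mspace X" for x
    using Lipschitz_continuous_map_image[OF gL] that by auto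
  obtain C where C: "C > 0"
    "\<And>x y. x \<in> mspace X \<Longrightarrow> y \<in> mspace X \<Longrightarrow> mdist Y (g x) (g y) \<le> C * mdist X x y"
    using gL by (auto simp: Lipschitz_continuous_map_pos)
  have "mdist Y (g x) (g y) = mdist X x y" if xy: "x \<in> mspace X" "y \<in> mspace X" for x y
  proof (rule ccontr)
    assume ne: "mdist Y (g x) (g y) \<noteq> mdist X x y"
    define e where "e = \<bar>mdist Y (g x) (g y) - mdist X x y\<bar> / (2 * (C + 1))"
    have e: "0 < e" using ne C(1) by (simp add: e_def)
    obtain x' where x': "x' \<in> D" "mdist X x x' < e" "x' \<in> mspace X"
      using mdist_less_of_closure[of x X D e] D xy e by auto
    obtain y' where y': "y' \<in> D" "mdist X y y' < e" "y' \<in> mspace X"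
      using mdist_less_of_closure[of y X D e] D xy e by auto
    have Ce: "mdist Y (g x) (g x') < C * e" "mdist Y (g y) (g y') < C * e"
      using C(2)[of x x'] C(2)[of y y'] x' y' xy C(1)
      by (meson le_less_trans mult_strict_left_mono)+
    have eq: "mdist Y (g x') (g y') = mdist X x' y'" using x' y' by (simp add: gf fd)
    have 1: "\<bar>mdist X x y - mdist X x' y'\<bar> < 2 * e"
      using X.triangle[of x x' y] X.triangle[of x' y' y] X.triangle[of x' x y'] X.triangle[of x y y']
        x' y' xy by (auto simp: X.commute)
    have 2: "\<bar>mdist Y (g x) (g y) - mdist Y (g x') (g y')\<bar> < 2 * (C * e)"
      using Y.triangle[of "g x" "g x'" "g y"] Y.triangle[of "g x'" "g y'" "g y"]
        Y.triangle[of "g x'" "g x" "g y'"] Y.triangle[of "g x" "g y" "g y'"]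
        gY x' y' xy Ce by (auto simp: Y.commute)
    have "\<bar>mdist Y (g x) (g y) - mdist X x y\<bar> < 2 * (C * e) + 2 * e"
      using 1 2 eq by linarith
    also have "\<dots> = e * (2 * (C + 1))" by (simp add: algebra_simps)
    also have "\<dots> = \<bar>mdist Y (g x) (g y) - mdist X x y\<bar>"
      using C(1) by (simp add: e_def)
    finally show False by simp
  qed
  then show thesis using that[of g] gf gY by (simp add: isometric_embedding_def)
qed

lemma hom_Iso_of_action:
  fixes X :: "'a metric" and K :: "('k, 'm) monoid_scheme"
  assumes K: "group K" and act: "isometric_action K (mdist X) (mspace X) \<alpha>"
  shows "(\<lambda>k. restrict (\<alpha> k) (mspace X)) \<in> hom K (Iso X)"
proof -
  interpret K: group K by fact
  note a = isometric_actionD[OF act]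
  have surj: "\<alpha> k ` mspace X = mspace X" if k: "k \<in> carrier K" for k
  proof
    show "\<alpha> k ` mspace X \<subseteq> mspace X" using a(1) k by auto
    show "mspace X \<subseteq> \<alpha> k ` mspace X"
    proof
      fix x assume x: "x \<in> mspace X"
      then have "x = \<alpha> k (\<alpha> (inv\<^bsub>K\<^esub> k) x)" using a(2,3) k by (metis K.inv_closed K.r_inv)
      then show "x \<in> \<alpha> k ` mspace X" using a(1)[of "inv\<^bsub>K\<^esub> k" x] k x by simp
    qed
  qed
  have iso: "isometry X X (restrict (\<alpha> k) (mspace X))" if "k \<in> carrier K" for k
    using that a(1,4) surj by (auto simp: isometry_def isometric_embedding_def)
  then have Bij: "restrict (\<alpha> k) (mspace X) \<in> Bij (mspace X)" if "k \<in> carrier K" for k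
    using that by (intro isometry_Bij) auto
  show ?thesis
  proof (rule homI)
    fix k assume k: "k \<in> carrier K"
    then show "restrict (\<alpha> k) (mspace X) \<in> carrier (Iso X)"
      by (simp add: Iso_def iso Bij)
    fix l assume l: "l \<in> carrier K"
    then show "restrict (\<alpha> (k \<otimes>\<^bsub>K\<^esub> l)) (mspace X)
        = restrict (\<alpha> k) (mspace X) \<otimes>\<^bsub>Iso X\<^esub> restrict (\<alpha> l) (mspace X)"
      using k a(1,3) Bij by (auto simp: Iso_def BijGroup_def compose_def fun_eq_iff)
  qed
qed

text \<open>Finite stages \<open>S n\<close> with actions \<open>\<beta> n\<close> are built so that stage \<open>n + 1\<close> swallows the \<open>n\<close>-th point of
a countable dense set. Their union \<open>D\<close> is dense and carries the limit action \<open>\<gamma>\<close>. Each \<open>\<gamma> k\<close> extends to \<open>U\<close>,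
and the action laws survive because isometric maps agreeing on \<open>D\<close> agree everywhere.\<close>

lemma finite_action_extends:
  fixes U :: "'u metric" and K :: "('k, 'm) monoid_scheme"
  assumes U: "urysohn_space U" and K: "group K" "finite (carrier K)"
    and Z: "finite Z" "Z \<subseteq> mspace U" and act: "isometric_action K (mdist U) Z \<alpha>"
  obtains \<theta> where "\<theta> \<in> hom K (Iso U)" "\<And>k z. k \<in> carrier K \<Longrightarrow> z \<in> Z \<Longrightarrow> \<theta> k z = \<alpha> k z"
proof (cases "mspace U = {}")
  case True
  then have "isometric_action K (mdist U) (mspace U) \<alpha>" by (simp add: isometric_action_def)
  from that[OF hom_Iso_of_action[OF K(1) this]] show thesis using True Z(2) by auto
next
  case False
  interpret K: group K by fact
  obtain C where C: "countable C" "C \<subseteq> mspace U" "mtopology_of U closure_of C = mspace U"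
    using U by (auto simp: urysohn_space_def separable_space_def)
  have "C \<noteq> {}" using C(3) False by auto
  define e where "e = from_nat_into C"
  have e: "range e = C" using C(1) \<open>C \<noteq> {}\<close> by (simp add: e_def range_from_nat_into)
  let ?P = "\<lambda>(n::nat) (S, \<beta>). finite S \<and> S \<subseteq> mspace U \<and> isometric_action K (mdist U) S \<beta> \<and>
               Z \<subseteq> S \<and> (\<forall>k\<in>carrier K. \<forall>z\<in>Z. \<beta> k z = \<alpha> k z)"
  let ?Q = "\<lambda>n (S, \<beta>) (S', \<beta>'). e n \<in> S' \<and> S \<subseteq> S' \<and> (\<forall>k\<in>carrier K. \<forall>z\<in>S. \<beta>' k z = \<beta> k z)"
  have "\<exists>F. \<forall>n. ?P n (F n) \<and> ?Q n (F n) (F (Suc n))"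
  proof (rule dependent_nat_choice)
    show "\<exists>p. ?P 0 p" using Z act by (intro exI[of _ "(Z, \<alpha>)"]) simp
  next
    fix p n assume P: "?P n p"
    obtain S \<beta> where p: "p = (S, \<beta>)" by (cases p)
    have S: "finite S" "S \<subseteq> mspace U" "isometric_action K (mdist U) S \<beta>"
      "Z \<subseteq> S" "\<And>k z. k \<in> carrier K \<Longrightarrow> z \<in> Z \<Longrightarrow> \<beta> k z = \<alpha> k z"
      using P by (auto simp: p)
    have "e n \<in> mspace U" using e C(2) by auto
    then obtain S' \<beta>' where S': "finite S'" "S' \<subseteq> mspace U" "isometric_action K (mdist U) S' \<beta>'"
      "insert (e n) S \<subseteq> S'" "\<And>k z. k \<in> carrier K \<Longrightarrow> z \<in> S \<Longrightarrow> \<beta>' k z = \<beta> k z"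
      by (rule finite_action_adjoin_point[OF U K S(1-3)]) blast
    have "\<beta>' k z = \<alpha> k z" if "k \<in> carrier K" "z \<in> Z" for k z
      using S(4,5) S'(5) that by (metis subsetD)
    then show "\<exists>q. ?P (Suc n) q \<and> ?Q n p q"
      using S S' by (intro exI[of _ "(S', \<beta>')"]) (auto simp: p)
  qed
  then obtain F where F: "\<forall>n. ?P n (F n) \<and> ?Q n (F n) (F (Suc n))" ..
  define S where "S = (\<lambda>n. fst (F n))"
  define \<beta> where "\<beta> = (\<lambda>n. snd (F n))"
  have F_eq: "F n = (S n, \<beta> n)" for n by (simp add: S_def \<beta>_def)
  have F1: "?P n (S n, \<beta> n)" and F2: "?Q n (S n, \<beta> n) (S (Suc n), \<beta> (Suc n))" for n
    using F[THEN spec, of n] unfolding F_eq by (rule conjunct1, rule conjunct2)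
  have S: "S n \<subseteq> mspace U" "isometric_action K (mdist U) (S n) (\<beta> n)" "Z \<subseteq> S n"
    "k \<in> carrier K \<Longrightarrow> z \<in> Z \<Longrightarrow> \<beta> n k z = \<alpha> k z" for n k z
    using F1[of n] unfolding prod.case by blast+
  have Suc: "e n \<in> S (Suc n)" "S n \<subseteq> S (Suc n)"
    "k \<in> carrier K \<Longrightarrow> z \<in> S n \<Longrightarrow> \<beta> (Suc n) k z = \<beta> n k z" for n k z
    using F2[of n] unfolding prod.case by blast+
  note a = isometric_actionD[OF S(2)]
  have mono: "S m \<subseteq> S n" if "m \<le> n" for m n
    using that by (rule lift_Suc_mono_le[of S, OF Suc(2)])
  have stable: "\<beta> n k z = \<beta> m k z" if "m \<le> n" "k \<in> carrier K" "z \<in> S m" for m n k z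
    using that(1)
  proof (induction n rule: dec_induct)
    case (step i)
    then show ?case using Suc(3)[OF that(2), of z i] mono[of m i] that(3) by auto
  qed simp
  define D where "D = (\<Union>n. S n)"
  \<comment> \<open>The stages are compatible, so any stage containing \<open>z\<close> may be used to evaluate the limit action.\<close>
  define \<gamma> where "\<gamma> = (\<lambda>k z. \<beta> (LEAST n. z \<in> S n) k z)"
  have \<gamma>: "\<gamma> k z = \<beta> n k z" if "k \<in> carrier K" "z \<in> S n" for k z n
    unfolding \<gamma>_def
    by (rule stable[symmetric, OF _ that(1)]) (fact Least_le[of "\<lambda>n. z \<in> S n", OF that(2)]
      LeastI[of "\<lambda>n. z \<in> S n", OF that(2)])+
  have common: "\<exists>n. z \<in> S n \<and> w \<in> S n" if zw: "z \<in> D" "w \<in> D" for z w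
  proof -
    obtain m n where "z \<in> S m" "w \<in> S n" using zw by (auto simp: D_def)
    then have "z \<in> S (max m n) \<and> w \<in> S (max m n)"
      using mono[of m "max m n"] mono[of n "max m n"] by auto
    then show ?thesis ..
  qed
  have actD: "isometric_action K (mdist U) D \<gamma>"
    unfolding isometric_action_def
  proof (intro conjI ballI Pi_I)
    fix k z assume k: "k \<in> carrier K" and z: "z \<in> D"
    then obtain n where n: "z \<in> S n" by (auto simp: D_def)
    show "\<gamma> k z \<in> D" using a(1)[OF k n] \<gamma>[OF k n] by (auto simp: D_def)
    fix l assume l: "l \<in> carrier K"
    show "\<gamma> (k \<otimes>\<^bsub>K\<^esub> l) z = \<gamma> k (\<gamma> l z)"
      using a(3)[OF k l n] \<gamma>[OF _ n] \<gamma>[OF k a(1)[OF l n]] k l by simp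
  next
    fix k z w assume k: "k \<in> carrier K" and "z \<in> D" "w \<in> D"
    then obtain n where n: "z \<in> S n" "w \<in> S n" using common by blast
    show "mdist U (\<gamma> k z) (\<gamma> k w) = mdist U z w" using a(4)[OF k n] \<gamma>[OF k] n by simp
  next
    fix z assume "z \<in> D"
    then obtain n where n: "z \<in> S n" by (auto simp: D_def)
    show "\<gamma> \<one>\<^bsub>K\<^esub> z = z" using a(2)[OF n] \<gamma>[OF K.one_closed n] by simp
  qed
  note b = isometric_actionD[OF actD]
  have DU: "D \<subseteq> mspace U" using S(1) by (auto simp: D_def)
  have "C \<subseteq> D" using e Suc(1) by (auto simp: D_def)
  then have dense: "mtopology_of U closure_of D = mspace U"
    using closure_of_mono[of C D "mtopology_of U"] C(3) closure_of_subset_topspace[of "mtopology_of U" D]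
    by auto
  have "\<exists>g. isometric_embedding U U g \<and> (\<forall>x\<in>D. g x = \<gamma> k x)" if k: "k \<in> carrier K" for k
  proof -
    have "mcomplete_of U" using U by (simp add: urysohn_space_def)
    moreover have "\<gamma> k \<in> D \<rightarrow> mspace U" using b(1)[OF k] DU by auto
    ultimately show ?thesis
      by (rule isometric_embedding_extends_from_dense[OF _ DU dense _ b(4)[OF k]]) auto
  qed
  then obtain g where g: "\<And>k. k \<in> carrier K \<Longrightarrow> isometric_embedding U U (g k)"
    "\<And>k x. k \<in> carrier K \<Longrightarrow> x \<in> D \<Longrightarrow> g k x = \<gamma> k x" by metis
  have "isometric_action K (mdist U) (mspace U) g"
    unfolding isometric_action_def
  proof (intro conjI ballI)
    fix x assume x: "x \<in> mspace U"
    have "isometric_embedding U U (\<lambda>x. x)" by (simp add: isometric_embedding_def)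
    then show "g \<one>\<^bsub>K\<^esub> x = x"
      by (rule isometric_embedding_eq_on_dense[OF g(1)[OF K.one_closed] _ dense _ x])
        (simp add: g(2) b(2))
    fix k l assume kl: "k \<in> carrier K" "l \<in> carrier K"
    have "isometric_embedding U U (\<lambda>x. g k (g l x))"
      using g(1)[OF kl(1)] g(1)[OF kl(2)] by (auto simp: isometric_embedding_def Pi_iff)
    then show "g (k \<otimes>\<^bsub>K\<^esub> l) x = g k (g l x)"
      by (rule isometric_embedding_eq_on_dense[OF g(1)[OF K.m_closed[OF kl]] _ dense _ x])
        (simp add: g(2) b(1,3) kl)
  qed (use g(1) in \<open>auto simp: isometric_embedding_def\<close>)
  from hom_Iso_of_action[OF K(1) this] show thesis
  proof (rule that)
    fix k z assume k: "k \<in> carrier K" and z: "z \<in> Z"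
    have "z \<in> S 0" using S(3) z by auto
    moreover from this have "z \<in> D" "z \<in> mspace U" using S(1) by (auto simp: D_def)
    ultimately show "restrict (g k) (mspace U) z = \<alpha> k z"
      using g(2)[OF k] \<gamma>[OF k] S(4)[OF k z] by simp
  qed
qed

section \<open>Finite quotients and word length\<close>

text \<open>Each element of \<open>B\<close> is missed by a subgroup \<open>H b\<close> of finite index. The group acts on the finite sets of cosets of
all the \<open>H b\<close> by right multiplication, so the kernel \<open>N\<close> of this action is normal of finite index. It is contained in
every \<open>H b\<close> and therefore avoids \<open>B\<close>.\<close>

lemma residually_finite_normal_subgroup:
  fixes G :: "('g, 'b) monoid_scheme" (structure)
  assumes G: "residually_finite G" and B: "finite B" "B \<subseteq> carrier G" "\<one> \<notin> B"
  obtains N where "N \<lhd> G" "finite (rcosets N)" "N \<inter> B = {}"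
proof -
  interpret group G using G by (simp add: residually_finite_def)
  have "\<exists>H. subgroup H G \<and> finite (rcosets H) \<and> b \<notin> H" if "b \<in> B" for b
  proof (rule ccontr)
    assume "\<not> ?thesis"
    then have "b \<in> carrier G \<inter> \<Inter>{H. subgroup H G \<and> finite (rcosets H)}"
      using B(2) that by blast
    moreover have "carrier G \<inter> \<Inter>{H. subgroup H G \<and> finite (rcosets H)} = {\<one>}"
      using G by (simp add: residually_finite_def)
    ultimately have "b \<in> {\<one>}" by metis
    then show False using B(3) that by simp
  qed
  then obtain H where H: "\<And>b. b \<in> B \<Longrightarrow> subgroup (H b) G"
    "\<And>b. b \<in> B \<Longrightarrow> finite (rcosets H b)" "\<And>b. b \<in> B \<Longrightarrow> b \<notin> H b" by metis
  define N where "N = {g \<in> carrier G. \<forall>b\<in>B. \<forall>x\<in>carrier G. x \<otimes> g \<otimes> inv x \<in> H b}"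
  have conj_mult: "x \<otimes> (g \<otimes> h) \<otimes> inv x = (x \<otimes> g \<otimes> inv x) \<otimes> (x \<otimes> h \<otimes> inv x)"
    if "x \<in> carrier G" "g \<in> carrier G" "h \<in> carrier G" for x g h
    using that by (simp add: m_assoc inv_solve_left flip: m_assoc[of "inv x" x])
  have conj_inv: "x \<otimes> inv g \<otimes> inv x = inv (x \<otimes> g \<otimes> inv x)"
    if "x \<in> carrier G" "g \<in> carrier G" for x g
    using that by (simp add: inv_mult_group m_assoc)
  have "subgroup N G"
  proof (rule subgroupI)
    show "N \<subseteq> carrier G" by (auto simp: N_def)
    have "\<one> \<in> N" using H(1) by (auto simp: N_def subgroup.one_closed)
    then show "N \<noteq> {}" by blast
    show "inv g \<in> N" if "g \<in> N" for g
      using that H(1) by (auto simp: N_def conj_inv subgroup.m_inv_closed)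
    show "g \<otimes> h \<in> N" if "g \<in> N" "h \<in> N" for g h
      using that H(1) by (auto simp: N_def conj_mult subgroup.m_closed)
  qed
  moreover have "y \<otimes> g \<otimes> inv y \<in> N" if "y \<in> carrier G" "g \<in> N" for y g
  proof -
    have "x \<otimes> (y \<otimes> g \<otimes> inv y) \<otimes> inv x = (x \<otimes> y) \<otimes> g \<otimes> inv (x \<otimes> y)" if "x \<in> carrier G" for x
      using that \<open>y \<in> carrier G\<close> \<open>g \<in> N\<close> by (simp add: N_def inv_mult_group m_assoc)
    then show ?thesis using that by (auto simp: N_def)
  qed
  ultimately have N: "N \<lhd> G" by (simp add: normal_inv_iff)
  interpret N: normal N G by fact
  \<comment> \<open>\<open>\<Theta> g\<close> is the simultaneous permutation of the cosets induced by \<open>g\<close>; its fibres are the cosets of \<open>N\<close>.\<close>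
  define \<Theta> where "\<Theta> = (\<lambda>g. \<lambda>b\<in>B. \<lambda>C\<in>rcosets H b. C #> g)"
  have "\<Theta> ` carrier G \<subseteq> (\<Pi>\<^sub>E b\<in>B. \<Pi>\<^sub>E C\<in>rcosets H b. rcosets H b)"
  proof -
    have "C #> g \<in> rcosets H b" if b: "b \<in> B" and g: "g \<in> carrier G" and C: "C \<in> rcosets H b" for b g C
    proof -
      obtain x where x: "x \<in> carrier G" "C = H b #> x"
        using C by (auto simp: RCOSETS_def)
      then have "C #> g = H b #> (x \<otimes> g)"
        using coset_mult_assoc[OF subgroup.subset[OF H(1)[OF b]]] g by simp
      then show ?thesis using x g by (auto simp: RCOSETS_def)
    qed
    then show ?thesis by (auto simp: \<Theta>_def)
  qed
  then have fin: "finite (\<Theta> ` carrier G)"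
    by (rule finite_subset) (intro finite_PiE B(1) H(2))
  have coset_eq: "N #> g = N #> h" if "g \<in> carrier G" "h \<in> carrier G" "\<Theta> g = \<Theta> h" for g h
  proof -
    have "x \<otimes> (g \<otimes> inv h) \<otimes> inv x \<in> H b" if b: "b \<in> B" and x: "x \<in> carrier G" for b x
    proof -
      note Hb = H(1)[OF b]
      have "\<Theta> g b (H b #> x) = \<Theta> h b (H b #> x)" using \<open>\<Theta> g = \<Theta> h\<close> by simp
      moreover have "H b #> x \<in> rcosets H b" using x by (auto simp: RCOSETS_def)
      ultimately have "H b #> x #> g = H b #> x #> h" using b by (simp add: \<Theta>_def)
      then have "H b #> (x \<otimes> g) = H b #> (x \<otimes> h)"
        using coset_mult_assoc[OF subgroup.subset[OF Hb]] x \<open>g \<in> carrier G\<close> \<open>h \<in> carrier G\<close> by simp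
      then have "(x \<otimes> g) \<otimes> inv (x \<otimes> h) \<in> H b"
        using x \<open>g \<in> carrier G\<close> \<open>h \<in> carrier G\<close> Hb
        by (metis m_closed subgroup.rcos_module_imp group_axioms rcos_self)
      then show ?thesis
        using x \<open>g \<in> carrier G\<close> \<open>h \<in> carrier G\<close> by (simp add: inv_mult_group m_assoc)
    qed
    then have "g \<otimes> inv h \<in> N" using that(1,2) unfolding N_def by simp
    then have "g \<in> N #> h" using that(1,2) by (simp add: N.rcos_module[OF is_group])
    then show ?thesis using repr_independence[OF _ that(2) N.subgroup_axioms] by simp
  qed
  have "finite (rcosets N)"
  proof -
    define s where "s = inv_into (carrier G) \<Theta>"
    have s: "s (\<Theta> g) \<in> carrier G" "\<Theta> (s (\<Theta> g)) = \<Theta> g" if "g \<in> carrier G" for g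
      unfolding s_def using that by (simp_all add: inv_into_into f_inv_into_f)
    have "rcosets N \<subseteq> (\<lambda>t. N #> s t) ` \<Theta> ` carrier G"
    proof
      fix C assume "C \<in> rcosets N"
      then obtain g where g: "g \<in> carrier G" "C = N #> g" by (auto simp: RCOSETS_def)
      then have "C = N #> s (\<Theta> g)" using coset_eq[OF g(1) s(1) s(2)[symmetric]] by simp
      then show "C \<in> (\<lambda>t. N #> s t) ` \<Theta> ` carrier G" using g(1) by blast
    qed
    then show ?thesis using fin finite_subset by blast
  qed
  moreover have "b \<notin> N" if "b \<in> B" for b
  proof
    assume "b \<in> N"
    then have "\<one> \<otimes> b \<otimes> inv \<one> \<in> H b" using that unfolding N_def by blast
    then show False using H(3)[OF that] B(2) that by auto
  qed
  ultimately show thesis using that N by blast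
qed

text \<open>The word length with respect to \<open>S\<close> and its inverses, cut off at \<open>M\<close>. The cut-off gives a value to
elements outside the subgroup generated by \<open>S\<close> while keeping the balls of radius less than \<open>M\<close> finite.\<close>

lemma exists_truncated_word_length:
  fixes G :: "('g, 'b) monoid_scheme" (structure) and M :: nat
  assumes G: "group G" and S: "finite S" "S \<subseteq> carrier G"
  obtains l :: "'g \<Rightarrow> nat" where
    "l \<one> = 0"
    "\<And>g. g \<in> carrier G \<Longrightarrow> l (inv g) = l g"
    "\<And>g h. g \<in> carrier G \<Longrightarrow> h \<in> carrier G \<Longrightarrow> l (g \<otimes> h) \<le> l g + l h"
    "\<And>s. s \<in> S \<Longrightarrow> l s \<le> 1"
    "finite {g \<in> carrier G. l g < M}"
proof -
  interpret group G by fact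
  define T where "T = S \<union> m_inv G ` S"
  have T: "finite T" "T \<subseteq> carrier G" "\<And>t. t \<in> T \<Longrightarrow> inv t \<in> T"
    using S by (auto simp: T_def)
  \<comment> \<open>\<open>W n\<close> consists of the products of \<open>n\<close> letters.\<close>
  define W where "W = rec_nat {\<one>} (\<lambda>_ A. A <#> T)"
  have W0: "W 0 = {\<one>}" and WS: "\<And>n. W (Suc n) = W n <#> T"
    by (simp_all add: W_def)
  have Wc: "W n \<subseteq> carrier G" for n
    by (induction n) (use T(2) in \<open>auto simp: W0 WS set_mult_def\<close>)
  have Wfin: "finite (W n)" for n
  proof (induction n)
    case (Suc n)
    have "W (Suc n) = (\<lambda>(a, b). a \<otimes> b) ` (W n \<times> T)" by (auto simp: WS set_mult_def)
    then show ?case using Suc T(1) by simp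
  qed (simp add: W0)
  have Wadd: "g \<otimes> h \<in> W (m + n)" if "g \<in> W m" "h \<in> W n" for g h m n
    using that(2)
  proof (induction n arbitrary: h)
    case 0
    then show ?case using that(1) Wc[of m] by (auto simp: W0)
  next
    case (Suc n)
    then obtain a t where a: "a \<in> W n" "t \<in> T" "h = a \<otimes> t" by (auto simp: WS set_mult_def)
    then have "g \<otimes> h = (g \<otimes> a) \<otimes> t"
      using that(1) Wc T(2) by (metis m_assoc subsetD)
    then show ?case using Suc.IH[OF a(1)] a(2) by (auto simp: WS set_mult_def)
  qed
  have W1: "t \<in> W 1" if "t \<in> T" for t
    using that T(2) by (auto simp: WS W0 set_mult_def intro!: bexI[of _ t])
  have Winv: "inv g \<in> W n" if "g \<in> W n" for g n
    using that
  proof (induction n arbitrary: g)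
    case (Suc n)
    then obtain a t where a: "a \<in> W n" "t \<in> T" "g = a \<otimes> t" by (auto simp: WS set_mult_def)
    then have "inv g = inv t \<otimes> inv a" using Wc T(2) by (metis inv_mult_group subsetD)
    then show ?case using Wadd[OF W1[OF T(3)[OF a(2)]] Suc.IH[OF a(1)]] by simp
  qed (simp add: W0)
  define l where "l = (\<lambda>g. LEAST n. g \<in> W n \<or> n = M)"
  have l: "g \<in> W (l g) \<or> l g = M" for g
    unfolding l_def by (rule LeastI[of _ M]) simp
  have lW: "l g \<le> n" if "g \<in> W n" for g n
    unfolding l_def using that by (intro Least_le) simp
  have lM: "l g \<le> M" for g
    unfolding l_def by (intro Least_le) simp
  show thesis
  proof (rule that[of l])
    show "l \<one> = 0" using lW[of \<one> 0] by (simp add: W0)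
    have "l (inv g) \<le> l g" if "g \<in> carrier G" for g
      using l[of g] lW[OF Winv, of g] lM[of "inv g"] by auto
    then show "l (inv g) = l g" if "g \<in> carrier G" for g
      using that by (metis inv_closed inv_inv le_antisym)
    show "l (g \<otimes> h) \<le> l g + l h" for g h
      using l[of g] l[of h] lM[of "g \<otimes> h"] lW[OF Wadd, of g "l g" h "l h"] by auto
    show "l s \<le> 1" if "s \<in> S" for s
      using lW[OF W1, of s] that by (simp add: T_def)
    have "{g \<in> carrier G. l g < M} \<subseteq> (\<Union>n<M. W n)" using l by fastforce
    then show "finite {g \<in> carrier G. l g < M}"
      by (rule finite_subset) (simp add: Wfin)
  qed
qed

section \<open>The quotient of an invariant metric\<close>

text \<open>The case distinction only matters away from cosets: \<^locale>\<open>Metric_space\<close> demands that a distance be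
nonnegative and symmetric for all arguments, whereas the infimum of the empty set of reals is arbitrary.\<close>

definition quotient_dist ::
    "('g \<times> 'a \<Rightarrow> 'g \<times> 'a \<Rightarrow> real) \<Rightarrow> 'g set \<times> 'a \<Rightarrow> 'g set \<times> 'a \<Rightarrow> real" where
  "quotient_dist D x y =
     (if fst x = {} \<or> fst y = {} then 0
      else INF p \<in> fst x \<times> fst y. D (fst p, snd x) (snd p, snd y))"

lemma le_add_INF:
  fixes f :: "'a \<Rightarrow> real" and g :: "'b \<Rightarrow> real"
  assumes "S \<noteq> {}" "T \<noteq> {}" "\<And>v w. v \<in> S \<Longrightarrow> w \<in> T \<Longrightarrow> c \<le> f v + g w"
  shows "c \<le> (INF v\<in>S. f v) + (INF w\<in>T. g w)"
proof -
  have "c - f v \<le> (INF w\<in>T. g w)" if "v \<in> S" for v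
  proof (rule cINF_greatest[OF assms(2)])
    show "c - f v \<le> g w" if "w \<in> T" for w using assms(3)[OF \<open>v \<in> S\<close> that] by simp
  qed
  then have "c - (INF w\<in>T. g w) \<le> (INF v\<in>S. f v)"
    by (intro cINF_greatest[OF assms(1)]) (simp add: algebra_simps)
  then show ?thesis by simp
qed

text \<open>On \<open>G \<times> A\<close> the group acts freely by left multiplication of the first component.
The gap \<open>e\<close> keeps the infimum over two distinct orbits of a normal subgroup positive, and normality lets
\<open>G\<close> act on the set of orbits.\<close>

locale invariant_uniformly_discrete_metric = normal H G
  for H and G :: "('g, 'b) monoid_scheme" (structure) +
  fixes A :: "'a set" and D :: "'g \<times> 'a \<Rightarrow> 'g \<times> 'a \<Rightarrow> real" and e :: real
  assumes D_metric: "Metric_space (carrier G \<times> A) D"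
    and e: "0 < e" "\<And>x y. x \<in> carrier G \<times> A \<Longrightarrow> y \<in> carrier G \<times> A \<Longrightarrow> x \<noteq> y \<Longrightarrow> e \<le> D x y"
    and D_inv: "\<And>k g h a b. k \<in> carrier G \<Longrightarrow> g \<in> carrier G \<Longrightarrow> h \<in> carrier G \<Longrightarrow> a \<in> A \<Longrightarrow> b \<in> A \<Longrightarrow>
                  D (k \<otimes> g, a) (k \<otimes> h, b) = D (g, a) (h, b)"
begin

sublocale D: Metric_space "carrier G \<times> A" D by (rule D_metric)

lemma rcosets_nonempty: "C \<in> rcosets H \<Longrightarrow> C \<noteq> {}"
  using rcosets_non_empty by blast

lemma in_rcosets_carrier: "C \<in> rcosets H \<Longrightarrow> g \<in> C \<Longrightarrow> g \<in> carrier G"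
  using rcosets_carrier[OF is_group] by blast

lemma quotient_dist_le:
  assumes "g \<in> C" "h \<in> C'"
  shows "quotient_dist D (C, a) (C', b) \<le> D (g, a) (h, b)"
proof -
  have "bdd_below ((\<lambda>p. D (fst p, a) (snd p, b)) ` (C \<times> C'))"
    by (rule bdd_belowI2[of _ 0]) simp
  from cINF_lower[OF this, of "(g, h)"] show ?thesis
    using assms by (auto simp: quotient_dist_def)
qed

lemma le_quotient_dist:
  assumes "C \<in> rcosets H" "C' \<in> rcosets H" "\<And>g h. g \<in> C \<Longrightarrow> h \<in> C' \<Longrightarrow> c \<le> D (g, a) (h, b)"
  shows "c \<le> quotient_dist D (C, a) (C', b)"
  using assms rcosets_nonempty by (auto simp: quotient_dist_def intro!: cINF_greatest)

text \<open>For the triangle inequality, a pair \<open>(g, h)\<close> and a pair \<open>(h', k)\<close> with \<open>h\<close> and \<open>h'\<close> in the same coset have to be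
concatenated: translating the second pair by \<open>h h'\<^sup>-\<^sup>1 \<in> H\<close> leaves its length unchanged and makes the two pairs meet at \<open>h\<close>.\<close>

lemma Metric_space_quotient_dist: "Metric_space ((rcosets H) \<times> A) (quotient_dist D)"
proof
  fix x y z :: "'g set \<times> 'a"
  obtain C a C' b C'' c where xyz: "x = (C, a)" "y = (C', b)" "z = (C'', c)" 
    by (metis surj_pair)
  show "0 \<le> quotient_dist D x y"
    by (auto simp: quotient_dist_def intro!: cINF_greatest)
  show "quotient_dist D x y = quotient_dist D y x"
  proof -
    have "(\<lambda>p. D (fst p, a) (snd p, b)) ` (C \<times> C') = (\<lambda>p. D (fst p, b) (snd p, a)) ` (C' \<times> C)"
      by (force simp: D.commute)
    then show ?thesis by (auto simp: quotient_dist_def xyz)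
  qed
  assume x: "x \<in> (rcosets H) \<times> A" and y: "y \<in> (rcosets H) \<times> A"
  show "quotient_dist D x y = 0 \<longleftrightarrow> x = y"
  proof
    assume 0: "quotient_dist D x y = 0"
    show "x = y"
    proof (rule ccontr)
      assume ne: "x \<noteq> y"
      have "e \<le> quotient_dist D x y"
        unfolding xyz
      proof (rule le_quotient_dist)
        fix g h assume gh: "g \<in> C" "h \<in> C'"
        have "(g, a) \<noteq> (h, b)"
        proof
          assume eq: "(g, a) = (h, b)"
          then have "g \<in> C \<inter> C'" using gh by simp
          then have "C = C'"
            using rcos_disjoint[OF subgroup_axioms] x y xyz by (auto simp: pairwise_def disjnt_def)
          then show False using ne eq xyz by simp
        qed
        then show "e \<le> D (g, a) (h, b)"
          using gh x y by (intro e(2)) (auto simp: xyz in_rcosets_carrier)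
      qed (use x y xyz in auto)
      then show False using 0 e(1) by simp
    qed
  next
    assume "x = y"
    obtain g where "g \<in> C" using x rcosets_nonempty xyz by auto
    then have "quotient_dist D x y \<le> D (g, a) (g, a)" "(g, a) \<in> carrier G \<times> A"
      using quotient_dist_le[of g C g C] \<open>x = y\<close> xyz x in_rcosets_carrier by auto
    then show "quotient_dist D x y = 0"
      using le_quotient_dist[of C C' 0] x y xyz by (simp add: antisym)
  qed
  assume z: "z \<in> (rcosets H) \<times> A"
  show "quotient_dist D x z \<le> quotient_dist D x y + quotient_dist D y z"
  proof -
    have ne: "fst x \<noteq> {}" "fst y \<noteq> {}" "fst z \<noteq> {}" using x y z rcosets_nonempty by auto
    have "quotient_dist D x z \<le> (INF p \<in> fst x \<times> fst y. D (fst p, snd x) (snd p, snd y)) +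
            (INF q \<in> fst y \<times> fst z. D (fst q, snd y) (snd q, snd z))"
    proof (rule le_add_INF)
      fix p q assume p: "p \<in> fst x \<times> fst y" and q: "q \<in> fst y \<times> fst z"
      obtain g h h' k where pq: "p = (g, h)" "q = (h', k)" by (metis surj_pair)
      have in_C: "g \<in> C" "h \<in> C'" "h' \<in> C'" "k \<in> C''" using p q pq xyz by auto
      have carr: "g \<in> carrier G" "h \<in> carrier G" "h' \<in> carrier G" "k \<in> carrier G"
        using in_C x y z xyz in_rcosets_carrier by auto
      have abc: "a \<in> A" "b \<in> A" "c \<in> A" using x y z xyz by auto
      define n where "n = h \<otimes> inv h'"
      obtain r where r: "r \<in> carrier G" "C'' = H #> r" using z xyz by (auto simp: RCOSETS_def)
      obtain s where s: "s \<in> carrier G" "C' = H #> s" using y xyz by (auto simp: RCOSETS_def)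
      have nH: "n \<in> H"
      proof -
        have "C' = H #> h'" using repr_independence[OF _ s(1) subgroup_axioms] in_C(3) s(2) by blast
        then show ?thesis using rcos_module_imp[OF is_group carr(3)] in_C(2) by (simp add: n_def)
      qed
      then have nc: "n \<in> carrier G" by simp
      have "n \<otimes> k \<in> C''"
      proof -
        have "C'' = H #> k" using repr_independence[OF _ r(1) subgroup_axioms] in_C(4) r(2) by blast
        then show ?thesis using nH by (auto simp: r_coset_def)
      qed
      then have "quotient_dist D x z \<le> D (g, a) (n \<otimes> k, c)"
        using quotient_dist_le in_C(1) xyz by simp
      also have "\<dots> \<le> D (g, a) (n \<otimes> h', b) + D (n \<otimes> h', b) (n \<otimes> k, c)"
        using carr nc abc by (intro D.triangle) auto
      also have "n \<otimes> h' = h" using carr by (simp add: n_def m_assoc)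
      also have "D (h, b) (n \<otimes> k, c) = D (h', b) (k, c)"
        using D_inv[of n h' k b c] carr nc abc \<open>n \<otimes> h' = h\<close> by simp
      finally show "quotient_dist D x z \<le> D (fst p, snd x) (snd p, snd y) + D (fst q, snd y) (snd q, snd z)"
        by (simp add: pq xyz)
    qed (use ne in auto)
    then show ?thesis using ne by (simp add: quotient_dist_def)
  qed
qed

text \<open>It suffices that translations do not increase distances, since their inverses are translations as well.\<close>

lemma isometric_action_quotient:
  "isometric_action (G Mod H) (quotient_dist D) ((rcosets H) \<times> A) (\<lambda>C x. (C <#> fst x, snd x))"
proof -
  interpret Q: group "G Mod H" by (rule factorgroup_is_group)
  have carr: "carrier (G Mod H) = rcosets H" by (simp add: FactGroup_def)
  have le: "quotient_dist D (K <#> C, a) (K <#> C', b) \<le> quotient_dist D (C, a) (C', b)"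
    if K: "K \<in> rcosets H" and C: "C \<in> rcosets H" "C' \<in> rcosets H" and ab: "a \<in> A" "b \<in> A" for K C C' a b
  proof (rule le_quotient_dist[OF C])
    fix g h assume gh: "g \<in> C" "h \<in> C'"
    obtain k where k: "k \<in> K" using rcosets_nonempty[OF K] by blast
    then have "k \<otimes> g \<in> K <#> C" "k \<otimes> h \<in> K <#> C'" using gh by (auto simp: set_mult_def)
    then have "quotient_dist D (K <#> C, a) (K <#> C', b) \<le> D (k \<otimes> g, a) (k \<otimes> h, b)"
      by (rule quotient_dist_le)
    also have "\<dots> = D (g, a) (h, b)"
      using k gh K C ab in_rcosets_carrier by (intro D_inv) auto
    finally show "quotient_dist D (K <#> C, a) (K <#> C', b) \<le> D (g, a) (h, b)" .
  qed
  have closed: "K <#> C \<in> rcosets H" if "K \<in> rcosets H" "C \<in> rcosets H" for K C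
    using Q.m_closed[of K C] that by (simp add: carr)
  have eq: "quotient_dist D (K <#> C, a) (K <#> C', b) = quotient_dist D (C, a) (C', b)"
    if K: "K \<in> rcosets H" and C: "C \<in> rcosets H" "C' \<in> rcosets H" and ab: "a \<in> A" "b \<in> A" for K C C' a b
  proof (rule antisym[OF le[OF that]])
    define L where "L = inv\<^bsub>G Mod H\<^esub> K"
    have L: "L \<in> rcosets H" using Q.inv_closed[of K] K by (simp add: carr L_def)
    have cancel: "L <#> (K <#> C) = C" if "C \<in> rcosets H" for C
    proof -
      have "L \<otimes>\<^bsub>G Mod H\<^esub> (K \<otimes>\<^bsub>G Mod H\<^esub> C) = C"
        using K that unfolding L_def carr[symmetric]
        by (metis Q.m_assoc Q.l_inv Q.l_one Q.inv_closed)
      then show ?thesis by simp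
    qed
    show "quotient_dist D (C, a) (C', b) \<le> quotient_dist D (K <#> C, a) (K <#> C', b)"
      using le[OF L closed[OF K C(1)] closed[OF K C(2)] ab] cancel C by simp
  qed
  show ?thesis
    unfolding isometric_action_def carr
  proof (intro conjI ballI Pi_I)
    fix K x assume "K \<in> rcosets H" "x \<in> (rcosets H) \<times> A"
    then show "(K <#> fst x, snd x) \<in> (rcosets H) \<times> A" by (auto simp: closed)
  next
    fix x assume "x \<in> (rcosets H) \<times> A"
    then show "(\<one>\<^bsub>G Mod H\<^esub> <#> fst x, snd x) = x" using Q.l_one[of "fst x"] by (auto simp: carr)
  next
    fix K L x assume "K \<in> rcosets H" "L \<in> rcosets H" "x \<in> (rcosets H) \<times> A"
    then show "(K \<otimes>\<^bsub>G Mod H\<^esub> L <#> fst x, snd x) =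
         (K <#> fst (L <#> fst x, snd x), snd (L <#> fst x, snd x))"
      using Q.m_assoc[of K L "fst x"] by (auto simp: carr)
  next
    fix K x y assume "K \<in> rcosets H" "x \<in> (rcosets H) \<times> A" "y \<in> (rcosets H) \<times> A"
    then show "quotient_dist D (K <#> fst x, snd x) (K <#> fst y, snd y) = quotient_dist D x y"
      using eq[of K "fst x" "fst y" "snd x" "snd y"] by auto
  qed
qed

end

section \<open>Copying a pseudometric to a finite quotient\<close>

text \<open>Every value of \<open>\<delta> + e\<close> on \<open>F \<times> A\<close> is at most \<open>e * M\<close>. A translate \<open>n h\<close> with \<open>n \<in> N\<close> that could come closer to \<open>g\<close> than
this must satisfy \<open>l (g\<^sup>-\<^sup>1 n h) < M\<close>, which leaves only finitely many \<open>n\<close>; the set \<open>B\<close> collects those different from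
the identity for all \<open>g\<close> and \<open>h\<close> in \<open>F\<close>, and \<open>N\<close> is chosen disjoint from \<open>B\<close>. So the infimum that defines the quotient
distance is attained at \<open>n = \<one>\<close>.\<close>

lemma finite_quotient_metric:
  fixes G :: "('g, 'b) monoid_scheme" (structure) and \<delta> :: "'g \<times> 'a \<Rightarrow> 'g \<times> 'a \<Rightarrow> real"
  assumes G: "residually_finite G" and A: "finite A" and F: "finite F" "F \<subseteq> carrier G"
    and e: "0 < (e :: real)"
    and nonneg: "\<And>x y. 0 \<le> \<delta> x y" and commute: "\<And>x y. \<delta> x y = \<delta> y x"
    and diag: "\<And>x. x \<in> carrier G \<times> A \<Longrightarrow> \<delta> x x = 0"
    and triangle: "\<And>x y z. x \<in> carrier G \<times> A \<Longrightarrow> y \<in> carrier G \<times> A \<Longrightarrow> z \<in> carrier G \<times> A \<Longrightarrow>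
            \<delta> x z \<le> \<delta> x y + \<delta> y z"
    and invariant: "\<And>k g h a b. k \<in> carrier G \<Longrightarrow> g \<in> carrier G \<Longrightarrow> h \<in> carrier G \<Longrightarrow> a \<in> A \<Longrightarrow> b \<in> A \<Longrightarrow>
            \<delta> (k \<otimes> g, a) (k \<otimes> h, b) = \<delta> (g, a) (h, b)"
  obtains N d where "N \<lhd> G" "finite (rcosets N)" "Metric_space ((rcosets N) \<times> A) d"
    "isometric_action (G Mod N) d ((rcosets N) \<times> A) (\<lambda>C x. (C <#> fst x, snd x))"
    "\<And>g h a b. g \<in> F \<Longrightarrow> h \<in> F \<Longrightarrow> a \<in> A \<Longrightarrow> b \<in> A \<Longrightarrow>
        d (N #> g, a) (N #> h, b) = (if (g, a) = (h, b) then 0 else \<delta> (g, a) (h, b) + e)"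
proof -
  interpret group G using G by (simp add: residually_finite_def)
  have carrF: "g \<in> carrier G" if "g \<in> F" for g using F(2) that by blast
  obtain M :: nat where M: "\<And>x y. x \<in> F \<times> A \<Longrightarrow> y \<in> F \<times> A \<Longrightarrow> \<delta> x y + e \<le> e * real M"
  proof -
    let ?R = "(\<lambda>(x, y). \<delta> x y + e) ` ((F \<times> A) \<times> (F \<times> A))"
    have "finite ?R" using F(1) A by simp
    then have "bdd_above ?R" by (rule bdd_above_finite)
    then obtain R where R: "\<And>r. r \<in> ?R \<Longrightarrow> r \<le> R" unfolding bdd_above_def by metis
    obtain m :: nat where m: "R / e \<le> real m" using real_arch_simple by blast
    show thesis
    proof (rule that[of m])
      fix x y assume "x \<in> F \<times> A" "y \<in> F \<times> A"
      then have "(\<lambda>(x, y). \<delta> x y + e) (x, y) \<in> ?R" by (intro imageI) simp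
      then have "\<delta> x y + e \<in> ?R" by (simp only: prod.case)
      then have "\<delta> x y + e \<le> R" by (rule R)
      also have "R \<le> e * real m" using m e by (simp add: field_simps)
      finally show "\<delta> x y + e \<le> e * real m" .
    qed
  qed
  \<comment> \<open>With these letters, elements of \<open>F\<close> are at word distance at most 1, so the word metric stays below \<open>\<delta> + e\<close> on \<open>F \<times> A\<close>.\<close>
  define S where "S = (\<lambda>(g, h). inv g \<otimes> h) ` (F \<times> F)"
  have S: "finite S" "S \<subseteq> carrier G" using F(1) carrF by (auto simp: S_def)
  obtain l where l: "l \<one> = 0"
    "\<And>g. g \<in> carrier G \<Longrightarrow> l (inv g) = l g"
    "\<And>g h. g \<in> carrier G \<Longrightarrow> h \<in> carrier G \<Longrightarrow> l (g \<otimes> h) \<le> l g + l h"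
    "\<And>s. s \<in> S \<Longrightarrow> l s \<le> 1" "finite {g \<in> carrier G. l g < M}"
    by (rule exists_truncated_word_length[OF group_axioms S, of M]) blast
  define B where "B = (\<lambda>(g, w, h). g \<otimes> w \<otimes> inv h) ` (F \<times> {g \<in> carrier G. l g < M} \<times> F) - {\<one>}"
  have "finite B" unfolding B_def by (intro finite_Diff finite_imageI finite_cartesian_product F(1) l(5))
  moreover have "B \<subseteq> carrier G" using carrF by (auto simp: B_def)
  moreover have "\<one> \<notin> B" by (simp add: B_def)
  ultimately obtain N where N: "N \<lhd> G" "finite (rcosets N)" "N \<inter> B = {}"
    using residually_finite_normal_subgroup[OF G] by metis
  interpret N: normal N G by fact
  \<comment> \<open>The value 0 outside \<open>carrier G \<times> A\<close> keeps \<open>D\<close> symmetric where group inverses are meaningless.\<close>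
  define D where "D = (\<lambda>x y. if x = y \<or> x \<notin> carrier G \<times> A \<or> y \<notin> carrier G \<times> A then 0
                       else max (\<delta> x y + e) (e * real (l (inv (fst x) \<otimes> fst y))))"
  have l_sym: "l (inv g \<otimes> h) = l (inv h \<otimes> g)" if "g \<in> carrier G" "h \<in> carrier G" for g h
    using l(2)[of "inv g \<otimes> h"] that by (simp add: inv_mult_group)
  have l_tri: "l (inv g \<otimes> k) \<le> l (inv g \<otimes> h) + l (inv h \<otimes> k)"
    if "g \<in> carrier G" "h \<in> carrier G" "k \<in> carrier G" for g h k
  proof -
    have "inv g \<otimes> k = (inv g \<otimes> h) \<otimes> (inv h \<otimes> k)"
      using that by (simp add: m_assoc inv_solve_left' flip: m_assoc[of h "inv h" k])
    then show ?thesis using l(3)[of "inv g \<otimes> h" "inv h \<otimes> k"] that by simp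
  qed
  have D_ge: "e \<le> D x y" if "x \<in> carrier G \<times> A" "y \<in> carrier G \<times> A" "x \<noteq> y" for x y
    using that nonneg[of x y] by (simp add: D_def)
  have D_refl: "D x x = 0" and D_nonneg: "0 \<le> D x y" for x y
    using nonneg[of x y] e by (simp_all add: D_def le_max_iff_disj)
  have D_metric: "Metric_space (carrier G \<times> A) D"
  proof
    fix x y z
    show "0 \<le> D x y" by (rule D_nonneg)
    show "D x y = D y x"
      using l_sym[of "fst x" "fst y"] by (auto simp: D_def commute[of x y])
    assume x: "x \<in> carrier G \<times> A" and y: "y \<in> carrier G \<times> A"
    show "D x y = 0 \<longleftrightarrow> x = y"
    proof
      show "x = y" if "D x y = 0" using D_ge[OF x y] that e by fastforce
    qed (simp add: D_refl)
    assume z: "z \<in> carrier G \<times> A"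
    show "D x z \<le> D x y + D y z"
    proof (cases "x = y \<or> y = z \<or> x = z")
      case True
      then show ?thesis using D_nonneg[of x y] D_nonneg[of y z] D_refl[of x] D_refl[of y] by auto
    next
      case False
      have "e * real (l (inv (fst x) \<otimes> fst z)) \<le>
          e * real (l (inv (fst x) \<otimes> fst y) + l (inv (fst y) \<otimes> fst z))"
        using l_tri[of "fst x" "fst y" "fst z"] x y z e by (intro mult_left_mono) auto
      then have len: "e * real (l (inv (fst x) \<otimes> fst z)) \<le>
          e * real (l (inv (fst x) \<otimes> fst y)) + e * real (l (inv (fst y) \<otimes> fst z))"
        by (simp add: distrib_left)
      have xy: "\<delta> x y + e \<le> D x y" "e * real (l (inv (fst x) \<otimes> fst y)) \<le> D x y"
        and yz: "\<delta> y z + e \<le> D y z" "e * real (l (inv (fst y) \<otimes> fst z)) \<le> D y z"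
        using False x y z by (simp_all add: D_def)
      have "D x z = max (\<delta> x z + e) (e * real (l (inv (fst x) \<otimes> fst z)))"
        using False x z by (simp add: D_def)
      also have "\<dots> \<le> D x y + D y z"
        using len xy yz triangle[OF x y z] e by (intro max.boundedI) linarith+
      finally show ?thesis .
    qed
  qed
  have D_inv: "D (k \<otimes> g, a) (k \<otimes> h, b) = D (g, a) (h, b)"
    if "k \<in> carrier G" "g \<in> carrier G" "h \<in> carrier G" "a \<in> A" "b \<in> A" for k g h a b
  proof -
    have "inv (k \<otimes> g) \<otimes> (k \<otimes> h) = inv g \<otimes> h"
      using that by (simp add: inv_mult_group m_assoc inv_solve_left' flip: m_assoc[of "inv k" k h])
    then show ?thesis using that by (simp add: D_def invariant)
  qed
  interpret Q: invariant_uniformly_discrete_metric N G A D e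
    by (intro invariant_uniformly_discrete_metric.intro
        invariant_uniformly_discrete_metric_axioms.intro N(1) D_metric e D_ge D_inv)
  have D_eq: "D (g, a) (h, b) = (if (g, a) = (h, b) then 0 else \<delta> (g, a) (h, b) + e)"
    if g: "g \<in> F" and h: "h \<in> F" and a: "a \<in> A" and b: "b \<in> A" for g h a b
  proof -
    have "real (l (inv g \<otimes> h)) \<le> 1" using l(4)[of "inv g \<otimes> h"] g h by (force simp: S_def)
    then have "e * real (l (inv g \<otimes> h)) \<le> e * 1" using e by (intro mult_left_mono) auto
    then have "e * real (l (inv g \<otimes> h)) \<le> \<delta> (g, a) (h, b) + e"
      using nonneg[of "(g, a)" "(h, b)"] by linarith
    then show ?thesis using carrF[OF g] carrF[OF h] a b by (simp add: D_def max_absorb1)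
  qed
  \<comment> \<open>Up to a common translation, a competitor for the infimum has the form \<open>(g, k h)\<close> with \<open>k \<in> N\<close>.\<close>
  have quotient_eq: "quotient_dist D (N #> g, a) (N #> h, b) = D (g, a) (h, b)"
    if g: "g \<in> F" and h: "h \<in> F" and a: "a \<in> A" and b: "b \<in> A" for g h a b
  proof (rule antisym)
    have gh: "g \<in> carrier G" "h \<in> carrier G" using carrF g h by auto
    have D_le: "D (g, a) (h, b) \<le> \<delta> (g, a) (h, b) + e"
      unfolding D_eq[OF that] using e by (simp add: nonneg add_nonneg_nonneg)
    show "quotient_dist D (N #> g, a) (N #> h, b) \<le> D (g, a) (h, b)"
      using gh by (intro Q.quotient_dist_le) (auto intro: rcos_self N.subgroup_axioms)
    show "D (g, a) (h, b) \<le> quotient_dist D (N #> g, a) (N #> h, b)"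
    proof (rule Q.le_quotient_dist)
      fix g' h' assume "g' \<in> N #> g" "h' \<in> N #> h"
      then obtain m n where m: "m \<in> N" "g' = m \<otimes> g" and n: "n \<in> N" "h' = n \<otimes> h"
        by (auto simp: r_coset_def)
      define k where "k = inv m \<otimes> n"
      have k: "k \<in> N" "k \<in> carrier G" using m n by (simp_all add: k_def)
      have "n \<otimes> h = m \<otimes> (k \<otimes> h)"
        using m n gh by (simp add: k_def flip: m_assoc)
      then have "D (g', a) (h', b) = D (g, a) (k \<otimes> h, b)"
        using D_inv[of m g "k \<otimes> h" a b] m n k gh a b by simp
      also have "D (g, a) (h, b) \<le> \<dots>"
      proof (cases "k = \<one>")
        case True
        then show ?thesis using gh by simp
      next
        case False
        have "M \<le> l (inv g \<otimes> (k \<otimes> h))"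
        proof (rule ccontr)
          assume "\<not> ?thesis"
          then have "g \<otimes> (inv g \<otimes> (k \<otimes> h)) \<otimes> inv h \<in> insert \<one> B"
            using g h gh k by (force simp: B_def)
          also have "g \<otimes> (inv g \<otimes> (k \<otimes> h)) \<otimes> inv h = k"
            using gh k by (simp add: m_assoc flip: m_assoc[of g "inv g"])
          finally show False using False k(1) N(3) by blast
        qed
        then have M_le: "e * real M \<le> e * real (l (inv g \<otimes> (k \<otimes> h)))" using e by simp
        have "(g, a) \<noteq> (k \<otimes> h, b)" 
        proof
          assume "(g, a) = (k \<otimes> h, b)"
          then have "inv g \<otimes> (k \<otimes> h) = \<one>" using gh by simp
          then have "e * real M \<le> 0" using M_le l(1) by simp
          then show False
            using M[of "(g, a)" "(h, b)"] g h a b nonneg[of "(g, a)" "(h, b)"] e by auto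
        qed
        then have "e * real (l (inv g \<otimes> (k \<otimes> h))) \<le> D (g, a) (k \<otimes> h, b)"
          using gh k a b by (auto simp: D_def)
        then show ?thesis using M_le D_le M[of "(g, a)" "(h, b)"] g h a b by auto
      qed
      finally show "D (g, a) (h, b) \<le> D (g', a) (h', b)" .
    qed (use gh in \<open>auto simp: RCOSETS_def\<close>)
  qed
  show thesis
    by (rule that[OF N(1,2) Q.Metric_space_quotient_dist Q.isometric_action_quotient])
      (simp add: quotient_eq D_eq)
qed

section \<open>Making room between points of the Urysohn space\<close>

text \<open>Take the sum metric on the product of the given points with a star: a centre \<open>None\<close> and, for every index, a leaf
\<open>Some i\<close> at distance \<open>e / 2\<close> from the centre. The copy over the centre is the original configuration, and moving the
\<open>i\<close>-th point to its own leaf adds \<open>e\<close> to all mutual distances, separating even indices with equal points.\<close>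

lemma perturbed_copy:
  fixes U :: "'u metric"
  assumes U: "urysohn_space U" and I: "finite I" and \<phi>: "\<phi> \<in> I \<rightarrow> mspace U" and e: "0 < (e :: real)"
  obtains \<psi> where "\<psi> \<in> I \<rightarrow> mspace U"
    "\<And>i. i \<in> I \<Longrightarrow> mdist U (\<psi> i) (\<phi> i) = e / 2"
    "\<And>i j. i \<in> I \<Longrightarrow> j \<in> I \<Longrightarrow> mdist U (\<psi> i) (\<psi> j) = mdist U (\<phi> i) (\<phi> j) + (if i = j then 0 else e)"
proof -
  interpret U: Metric_space "mspace U" "mdist U" by simp
  define h :: "'a option \<Rightarrow> real" where "h = case_option 0 (\<lambda>_. e / 2)"
  define d where "d = (\<lambda>(p, s) (q, t). mdist U p q + (if s = t then 0 else h s + h t))"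
  have h0: "0 \<le> h s" for s using e by (simp add: h_def split: option.split)
  have hpos: "0 < h s + h t" if "s \<noteq> t" for s t
    using that e by (cases s; cases t) (auto simp: h_def)
  define M where "M = \<phi> ` I \<times> insert None (Some ` I)"
  have \<phi>U: "\<phi> i \<in> mspace U" if "i \<in> I" for i using \<phi> that by (rule Pi_mem)
  have M: "Metric_space M d"
  proof
    fix x y z :: "'u \<times> 'a option"
    obtain p s q t r u where xyz: "x = (p, s)" "y = (q, t)" "z = (r, u)" by (metis surj_pair)
    show "0 \<le> d x y" using h0[of s] h0[of t] by (simp add: d_def xyz)
    show "d x y = d y x" by (simp add: d_def xyz U.commute)
    assume x: "x \<in> M" and y: "y \<in> M"
    have pq: "p \<in> mspace U" "q \<in> mspace U" using x y \<phi>U by (auto simp: M_def xyz)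
    show "d x y = 0 \<longleftrightarrow> x = y"
    proof (cases "s = t")
      case True
      then show ?thesis using pq by (simp add: d_def xyz)
    next
      case False
      then have "d x y = mdist U p q + (h s + h t)" by (simp add: d_def xyz)
      then have "0 < d x y" using hpos[OF False] U.nonneg[of p q] by linarith
      then show ?thesis using False by (simp add: xyz)
    qed
    assume z: "z \<in> M"
    have "r \<in> mspace U" using z \<phi>U by (auto simp: M_def xyz)
    then have "mdist U p r \<le> mdist U p q + mdist U q r" by (rule U.triangle[OF pq])
    then show "d x z \<le> d x y + d y z"
      using h0[of s] h0[of t] h0[of u] by (auto simp: d_def xyz)
  qed
  have finM: "finite M" using I by (simp add: M_def)
  have j: "(\<lambda>p. (p, None)) \<in> \<phi> ` I \<rightarrow> M" by (auto simp: M_def)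
  have idU: "(\<lambda>p. p) \<in> \<phi> ` I \<rightarrow> mspace U" using \<phi>U by auto
  obtain f where f: "f \<in> M \<rightarrow> mspace U"
    "\<And>x y. x \<in> M \<Longrightarrow> y \<in> M \<Longrightarrow> mdist U (f x) (f y) = d x y"
    "\<And>p. p \<in> \<phi> ` I \<Longrightarrow> f (p, None) = p"
    by (rule urysohn_extension[OF U M finM j idU]) (auto simp: d_def)
  have leaf: "(\<phi> i, Some i) \<in> M" "(\<phi> i, None) \<in> M" if "i \<in> I" for i
    using that by (auto simp: M_def)
  show thesis
  proof (rule that[of "\<lambda>i. f (\<phi> i, Some i)"])
    show "(\<lambda>i. f (\<phi> i, Some i)) \<in> I \<rightarrow> mspace U" using f(1) leaf by auto
    show "mdist U (f (\<phi> i, Some i)) (\<phi> i) = e / 2" if i: "i \<in> I" for i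
      using f(2)[OF leaf[OF i]] f(3)[of "\<phi> i"] i \<phi>U[OF i] by (simp add: d_def h_def)
    show "mdist U (f (\<phi> i, Some i)) (f (\<phi> j, Some j)) =
            mdist U (\<phi> i) (\<phi> j) + (if i = j then 0 else e)" if "i \<in> I" "j \<in> I" for i j
      using f(2)[OF leaf(1) leaf(1)] that by (simp add: d_def h_def)
  qed
qed

section \<open>Neighbourhoods of a representation\<close>

lemma Iso_topology_neighbourhood:
  fixes X :: "'a metric"
  assumes W: "openin (Iso_topology X) W" and f: "f \<in> W"
  obtains A e where "finite A" "A \<subseteq> mspace X" "0 < (e :: real)"
    "\<And>f'. f' \<in> carrier (Iso X) \<Longrightarrow> (\<And>a. a \<in> A \<Longrightarrow> mdist X (f a) (f' a) < e) \<Longrightarrow> f' \<in> W"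
proof -
  interpret X: Metric_space "mspace X" "mdist X" by simp
  obtain T where T: "openin (product_topology (\<lambda>_. mtopology_of X) (mspace X)) T"
    "W = T \<inter> carrier (Iso X)"
    using W by (auto simp: Iso_topology_def openin_subtopology)
  have "f \<in> T" using f T(2) by blast
  with T(1)[unfolded openin_product_topology_alt topspace_mtopology_of]
  have "\<exists>V. finite {a \<in> mspace X. V a \<noteq> mspace X} \<and>
      (\<forall>a\<in>mspace X. openin (mtopology_of X) (V a)) \<and> f \<in> Pi\<^sub>E (mspace X) V \<and>
      Pi\<^sub>E (mspace X) V \<subseteq> T"
    by (rule bspec)
  then obtain V where V: "finite {a \<in> mspace X. V a \<noteq> mspace X}"
    "\<forall>a\<in>mspace X. openin (mtopology_of X) (V a)" "f \<in> Pi\<^sub>E (mspace X) V"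
    "Pi\<^sub>E (mspace X) V \<subseteq> T"
    by (elim exE conjE) (rule that)
  define A where "A = {a \<in> mspace X. V a \<noteq> mspace X}"
  have "\<exists>r>0. X.mball (f a) r \<subseteq> V a" if "a \<in> A" for a
  proof -
    have "f a \<in> V a" "openin X.mtopology (V a)"
      using that V(2,3) by (auto simp: A_def mtopology_of_def)
    then show ?thesis by (auto simp: X.openin_mtopology)
  qed
  then obtain r where r: "\<And>a. a \<in> A \<Longrightarrow> 0 < r a" "\<And>a. a \<in> A \<Longrightarrow> X.mball (f a) (r a) \<subseteq> V a"
    by metis
  have fA: "finite A" using V(1) by (simp add: A_def)
  define e where "e = Min (insert 1 (r ` A))"
  have e: "0 < e" "\<And>a. a \<in> A \<Longrightarrow> e \<le> r a" using r(1) fA by (auto simp: e_def)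
  have Iso: "g \<in> extensional (mspace X)" "a \<in> mspace X \<Longrightarrow> g a \<in> mspace X"
    if "g \<in> carrier (Iso X)" for g a
    using that by (auto simp: Iso_def Bij_def isometry_def isometric_embedding_def)
  have fI: "f \<in> carrier (Iso X)" using f T(2) by blast
  show thesis
  proof (rule that[OF fA _ e(1)])
    show "A \<subseteq> mspace X" by (auto simp: A_def)
    fix g assume g: "g \<in> carrier (Iso X)" and close: "\<And>a. a \<in> A \<Longrightarrow> mdist X (f a) (g a) < e"
    have "g a \<in> V a" if a: "a \<in> mspace X" for a
    proof (cases "a \<in> A")
      case True
      have "mdist X (f a) (g a) < r a" using close[OF True] e(2)[OF True] by simp
      then have "g a \<in> X.mball (f a) (r a)" using Iso(2)[OF fI a] Iso(2)[OF g a] by simp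
      then show ?thesis using r(2)[OF True] by blast
    next
      case False
      then have "V a = mspace X" using a by (auto simp: A_def)
      then show ?thesis using Iso(2)[OF g a] by simp
    qed
    then have "g \<in> Pi\<^sub>E (mspace X) V" using Iso(1)[OF g] by (simp add: PiE_iff)
    then show "g \<in> W" using V(4) T(2) g by blast
  qed
qed

text \<open>The product topology restricts only finitely many group elements, and for each of them the topology of
pointwise convergence restricts only finitely many points.\<close>

lemma in_closure_of_Rep_topology:
  fixes G :: "('g, 'b) monoid_scheme" and X :: "'a metric"
  assumes \<rho>: "\<rho> \<in> Rep G X" and S: "S \<subseteq> Rep G X"
    and approx: "\<And>F A e. \<lbrakk>finite F; F \<subseteq> carrier G; finite A; A \<subseteq> mspace X; 0 < (e :: real)\<rbrakk> \<Longrightarrow>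
           \<exists>\<sigma>\<in>S. \<forall>g\<in>F. \<forall>a\<in>A. mdist X (\<rho> g a) (\<sigma> g a) < e"
  shows "\<rho> \<in> Rep_topology G X closure_of S"
  unfolding in_closure_of topspace_Rep_topology
proof (intro conjI allI impI \<rho>)
  fix W assume W: "\<rho> \<in> W \<and> openin (Rep_topology G X) W"
  then obtain T where T: "openin (product_topology (\<lambda>_. Iso_topology X) (carrier G)) T"
    "W = T \<inter> Rep G X"
    by (auto simp: Rep_topology_def openin_subtopology)
  have "\<rho> \<in> T" using W T(2) by blast
  with T(1)[unfolded openin_product_topology_alt topspace_Iso_topology]
  have "\<exists>V. finite {g \<in> carrier G. V g \<noteq> carrier (Iso X)} \<and>
      (\<forall>g\<in>carrier G. openin (Iso_topology X) (V g)) \<and> \<rho> \<in> Pi\<^sub>E (carrier G) V \<and>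
      Pi\<^sub>E (carrier G) V \<subseteq> T"
    by (rule bspec)
  then obtain V where V: "finite {g \<in> carrier G. V g \<noteq> carrier (Iso X)}"
    "\<forall>g\<in>carrier G. openin (Iso_topology X) (V g)" "\<rho> \<in> Pi\<^sub>E (carrier G) V"
    "Pi\<^sub>E (carrier G) V \<subseteq> T"
    by (elim exE conjE) (rule that)
  define F where "F = {g \<in> carrier G. V g \<noteq> carrier (Iso X)}"
  have "\<exists>A e. finite A \<and> A \<subseteq> mspace X \<and> 0 < (e::real) \<and>
      (\<forall>f'\<in>carrier (Iso X). (\<forall>a\<in>A. mdist X (\<rho> g a) (f' a) < e) \<longrightarrow> f' \<in> V g)" if "g \<in> F" for g
  proof -
    have "openin (Iso_topology X) (V g)" "\<rho> g \<in> V g" using that V(2,3) by (auto simp: F_def)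
    then obtain A and e :: real where "finite A" "A \<subseteq> mspace X" "0 < e"
      "\<And>f'. f' \<in> carrier (Iso X) \<Longrightarrow> (\<And>a. a \<in> A \<Longrightarrow> mdist X (\<rho> g a) (f' a) < e) \<Longrightarrow> f' \<in> V g"
      by (rule Iso_topology_neighbourhood) blast
    then show ?thesis by (intro exI[of _ A] exI[of _ e]) simp
  qed
  then obtain A e where Ae: "\<And>g. g \<in> F \<Longrightarrow> finite (A g)" "\<And>g. g \<in> F \<Longrightarrow> A g \<subseteq> mspace X"
    "\<And>g. g \<in> F \<Longrightarrow> 0 < (e g :: real)"
    "\<And>g f'. g \<in> F \<Longrightarrow> f' \<in> carrier (Iso X) \<Longrightarrow> (\<forall>a\<in>A g. mdist X (\<rho> g a) (f' a) < e g) \<Longrightarrow> f' \<in> V g"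
    by metis
  have fF: "finite F" using V(1) by (simp add: F_def)
  define \<epsilon> where "\<epsilon> = Min (insert 1 (e ` F))"
  have \<epsilon>: "0 < \<epsilon>" "\<And>g. g \<in> F \<Longrightarrow> \<epsilon> \<le> e g" using Ae(3) fF by (auto simp: \<epsilon>_def)
  have "\<exists>\<sigma>\<in>S. \<forall>g\<in>F. \<forall>a\<in>(\<Union>g\<in>F. A g). mdist X (\<rho> g a) (\<sigma> g a) < \<epsilon>"
  proof (rule approx)
    show "F \<subseteq> carrier G" by (auto simp: F_def)
  qed (use fF Ae(1,2) \<epsilon>(1) in auto)
  then obtain \<sigma> where \<sigma>: "\<sigma> \<in> S" "\<And>g a. g \<in> F \<Longrightarrow> a \<in> (\<Union>g\<in>F. A g) \<Longrightarrow> mdist X (\<rho> g a) (\<sigma> g a) < \<epsilon>"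
    by blast
  have \<sigma>R: "\<sigma> \<in> Rep G X" using \<sigma>(1) S by blast
  then have \<sigma>I: "\<sigma> g \<in> carrier (Iso X)" if "g \<in> carrier G" for g
    using that by (auto simp: Rep_def hom_def)
  have "\<sigma> g \<in> V g" if g: "g \<in> carrier G" for g
  proof (cases "g \<in> F")
    case True
    have "mdist X (\<rho> g a) (\<sigma> g a) < e g" if "a \<in> A g" for a
    proof -
      have "a \<in> (\<Union>g\<in>F. A g)" using that True by blast
      from \<sigma>(2)[OF True this] \<epsilon>(2)[OF True] show ?thesis by linarith
    qed
    then show ?thesis using Ae(4)[OF True \<sigma>I[OF g]] by blast
  next
    case False
    then have "V g = carrier (Iso X)" using g by (auto simp: F_def)
    then show ?thesis using \<sigma>I[OF g] by simp
  qed
  then have "\<sigma> \<in> Pi\<^sub>E (carrier G) V" using \<sigma>R by (simp add: PiE_iff Rep_def)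
  then have "\<sigma> \<in> W" using V(4) T(2) \<sigma>R by blast
  then show "\<exists>y. y \<in> S \<and> y \<in> W" using \<sigma>(1) by blast
qed

section \<open>Density of the representations with finite range\<close>

text \<open>The point \<open>\<psi> (\<one>, a)\<close> is close to \<open>a\<close> and \<open>\<psi> (g, a)\<close> is close to \<open>\<rho> g a\<close>, while \<open>\<sigma> g\<close> maps the former point exactly to the
latter. As \<open>\<sigma> g\<close> is an isometry, \<open>\<sigma> g a\<close> is within \<open>e / 2 + e / 2\<close> of \<open>\<rho> g a\<close>.\<close>

lemma finite_range_approximation:
  fixes G :: "('g, 'b) monoid_scheme" and U :: "'u metric"
  assumes G: "residually_finite G" and U: "urysohn_space U" and \<rho>: "\<rho> \<in> hom G (Iso U)"
    and F: "finite F" "F \<subseteq> carrier G" and A: "finite A" "A \<subseteq> mspace U" and e: "0 < (e :: real)"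
  obtains \<sigma> where "\<sigma> \<in> Rep G U" "finite (\<sigma> ` carrier G)"
    "\<And>g a. g \<in> F \<Longrightarrow> a \<in> A \<Longrightarrow> mdist U (\<rho> g a) (\<sigma> g a) \<le> e"
proof -
  interpret group G using G by (simp add: residually_finite_def)
  interpret U: Metric_space "mspace U" "mdist U" by simp
  have \<rho>_Iso: "\<rho> g \<in> carrier (Iso U)" if "g \<in> carrier G" for g
    using \<rho> that by (auto simp: hom_def)
  have Iso_dist: "mdist U (f x) (f y) = mdist U x y" and Iso_mem: "f x \<in> mspace U"
    if "f \<in> carrier (Iso U)" "x \<in> mspace U" "y \<in> mspace U" for f x y
    using that by (auto simp: Iso_def isometry_def isometric_embedding_def)
  have \<rho>_mult: "\<rho> (g \<otimes>\<^bsub>G\<^esub> h) x = \<rho> g (\<rho> h x)" if "g \<in> carrier G" "h \<in> carrier G" "x \<in> mspace U" for g h x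
  proof -
    have "\<rho> (g \<otimes>\<^bsub>G\<^esub> h) = \<rho> g \<otimes>\<^bsub>Iso U\<^esub> \<rho> h" using \<rho> that by (simp add: hom_def)
    then show ?thesis
      using \<rho>_Iso[OF that(1)] \<rho>_Iso[OF that(2)] that(3)
      by (simp add: Iso_def BijGroup_def compose_def)
  qed
  have \<rho>_one: "\<rho> \<one>\<^bsub>G\<^esub> x = x" if "x \<in> mspace U" for x
  proof -
    have "\<rho> \<one>\<^bsub>G\<^esub> = \<one>\<^bsub>Iso U\<^esub>" by (rule hom_one[OF \<rho> is_group group_Iso])
    then show ?thesis using that by (simp add: Iso_def BijGroup_def)
  qed
  \<comment> \<open>Including the identity ensures that the points of \<open>A\<close> themselves are represented.\<close>
  define F' where "F' = insert \<one>\<^bsub>G\<^esub> F"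
  have F': "finite F'" "F' \<subseteq> carrier G" using F by (auto simp: F'_def)
  define \<delta> where "\<delta> = (\<lambda>x y. mdist U (\<rho> (fst x) (snd x)) (\<rho> (fst y) (snd y)))"
  have \<rho>U: "\<rho> (fst x) (snd x) \<in> mspace U" if "x \<in> carrier G \<times> A" for x
    using that A(2) Iso_mem[OF \<rho>_Iso] by (auto simp: mem_Times_iff)
  obtain N d where N: "N \<lhd> G" "finite (rcosets\<^bsub>G\<^esub> N)" and
    d: "Metric_space ((rcosets\<^bsub>G\<^esub> N) \<times> A) d" and
    act: "isometric_action (G Mod N) d ((rcosets\<^bsub>G\<^esub> N) \<times> A) (\<lambda>C x. (C <#>\<^bsub>G\<^esub> fst x, snd x))" and
    d_eq: "\<And>g h a b. g \<in> F' \<Longrightarrow> h \<in> F' \<Longrightarrow> a \<in> A \<Longrightarrow> b \<in> A \<Longrightarrow>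
        d (N #>\<^bsub>G\<^esub> g, a) (N #>\<^bsub>G\<^esub> h, b) = (if (g, a) = (h, b) then 0 else \<delta> (g, a) (h, b) + e)"
  proof (rule finite_quotient_metric[OF G A(1) F' e, of \<delta>])
    show "\<delta> (k \<otimes>\<^bsub>G\<^esub> g, a) (k \<otimes>\<^bsub>G\<^esub> h, b) = \<delta> (g, a) (h, b)"
      if "k \<in> carrier G" "g \<in> carrier G" "h \<in> carrier G" "a \<in> A" "b \<in> A" for k g h a b
    proof -
      have "a \<in> mspace U" "b \<in> mspace U" using that A(2) by auto
      then show ?thesis
        using that \<rho>U[of "(g, a)"] \<rho>U[of "(h, b)"] by (simp add: \<delta>_def \<rho>_mult Iso_dist \<rho>_Iso)
    qed
    show "\<delta> x y = \<delta> y x" for x y by (simp add: \<delta>_def U.commute)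
    show "\<delta> x z \<le> \<delta> x y + \<delta> y z"
      if "x \<in> carrier G \<times> A" "y \<in> carrier G \<times> A" "z \<in> carrier G \<times> A" for x y z
      unfolding \<delta>_def using that by (intro U.triangle \<rho>U)
  qed (use \<rho>U in \<open>auto simp: \<delta>_def\<close>)
  interpret N: normal N G by (rule N(1))
  let ?M = "(rcosets\<^bsub>G\<^esub> N) \<times> A"
  let ?I = "F' \<times> A"
  have \<rho>I: "(\<lambda>x. \<rho> (fst x) (snd x)) \<in> ?I \<rightarrow> mspace U" using \<rho>U F'(2) by auto
  have finI: "finite ?I" using F'(1) A(1) by simp
  obtain \<psi> where \<psi>: "\<psi> \<in> ?I \<rightarrow> mspace U"
    "\<And>x. x \<in> ?I \<Longrightarrow> mdist U (\<psi> x) (\<rho> (fst x) (snd x)) = e / 2"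
    "\<And>x y. x \<in> ?I \<Longrightarrow> y \<in> ?I \<Longrightarrow> mdist U (\<psi> x) (\<psi> y) =
        mdist U (\<rho> (fst x) (snd x)) (\<rho> (fst y) (snd y)) + (if x = y then 0 else e)"
    by (rule perturbed_copy[OF U finI \<rho>I e]) blast
  have j: "(\<lambda>x. (N #>\<^bsub>G\<^esub> fst x, snd x)) \<in> ?I \<rightarrow> ?M" using F'(2) by (auto simp: RCOSETS_def)
  have finM: "finite ?M" using N(2) A(1) by simp
  obtain f where f: "f \<in> ?M \<rightarrow> mspace U"
    "\<And>x y. x \<in> ?M \<Longrightarrow> y \<in> ?M \<Longrightarrow> mdist U (f x) (f y) = d x y"
    "\<And>x. x \<in> ?I \<Longrightarrow> f (N #>\<^bsub>G\<^esub> fst x, snd x) = \<psi> x"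
  proof (rule urysohn_extension[OF U d finM j \<psi>(1)])
    show "mdist U (\<psi> x) (\<psi> y) = d (N #>\<^bsub>G\<^esub> fst x, snd x) (N #>\<^bsub>G\<^esub> fst y, snd y)"
      if xy: "x \<in> ?I" "y \<in> ?I" for x y
    proof -
      obtain g a h b where gh: "x = (g, a)" "y = (h, b)" by (metis surj_pair)
      have "(g, a) \<in> carrier G \<times> A" using xy(1) F'(2) by (auto simp: gh)
      then have "mdist U (\<psi> x) (\<psi> y) = (if (g, a) = (h, b) then 0 else \<delta> (g, a) (h, b) + e)"
        using \<psi>(3)[OF xy] \<rho>U[of "(g, a)"] by (auto simp: \<delta>_def gh)
      then show ?thesis using d_eq[of g h a b] xy by (simp add: gh)
    qed
  qed blast
  obtain \<beta> where \<beta>: "isometric_action (G Mod N) (mdist U) (f ` ?M) \<beta>"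
    "\<And>C x. C \<in> carrier (G Mod N) \<Longrightarrow> x \<in> ?M \<Longrightarrow> \<beta> C (f x) = f (C <#>\<^bsub>G\<^esub> fst x, snd x)"
    using isometric_action_transport[OF act d f(1,2)] by blast
  have carrQ: "carrier (G Mod N) = rcosets\<^bsub>G\<^esub> N" by (simp add: FactGroup_def)
  have fM: "finite (f ` ?M)" "f ` ?M \<subseteq> mspace U" using finM f(1) by auto
  have finQ: "finite (carrier (G Mod N))" using N(2) by (simp add: carrQ)
  obtain \<theta> where \<theta>: "\<theta> \<in> hom (G Mod N) (Iso U)"
    "\<And>C z. C \<in> carrier (G Mod N) \<Longrightarrow> z \<in> f ` ?M \<Longrightarrow> \<theta> C z = \<beta> C z"
    by (rule finite_action_extends[OF U N.factorgroup_is_group finQ fM \<beta>(1)]) blast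
  define \<sigma> where "\<sigma> = (\<lambda>g\<in>carrier G. \<theta> (N #>\<^bsub>G\<^esub> g))"
  have \<sigma>_hom: "\<sigma> \<in> hom G (Iso U)"
    using hom_compose[OF N.r_coset_hom_Mod \<theta>(1)] by (simp add: \<sigma>_def compose_def)
  show thesis
  proof (rule that[of \<sigma>])
    show "\<sigma> \<in> Rep G U" using \<sigma>_hom by (simp add: Rep_def \<sigma>_def)
    have "\<sigma> ` carrier G \<subseteq> \<theta> ` (rcosets\<^bsub>G\<^esub> N)" by (auto simp: \<sigma>_def RCOSETS_def)
    then show "finite (\<sigma> ` carrier G)" using N(2) finite_subset by blast
    fix g a assume g: "g \<in> F" and a: "a \<in> A"
    have gG: "g \<in> carrier G" and aU: "a \<in> mspace U" using g a F(2) A(2) by auto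
    have Ng: "N #>\<^bsub>G\<^esub> g \<in> rcosets\<^bsub>G\<^esub> N" and N1: "N #>\<^bsub>G\<^esub> \<one>\<^bsub>G\<^esub> \<in> rcosets\<^bsub>G\<^esub> N"
      using gG by (auto simp: RCOSETS_def)
    have I: "(g, a) \<in> ?I" "(\<one>\<^bsub>G\<^esub>, a) \<in> ?I" using g a by (auto simp: F'_def)
    have \<psi>U: "\<psi> (g, a) \<in> mspace U" "\<psi> (\<one>\<^bsub>G\<^esub>, a) \<in> mspace U" using \<psi>(1) I by auto
    have \<psi>f: "\<psi> (g, a) = f (N #>\<^bsub>G\<^esub> g, a)" "\<psi> (\<one>\<^bsub>G\<^esub>, a) = f (N #>\<^bsub>G\<^esub> \<one>\<^bsub>G\<^esub>, a)"
      using f(3)[OF I(1)] f(3)[OF I(2)] by simp_all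
    have \<sigma>g: "\<sigma> g \<in> carrier (Iso U)" using \<sigma>_hom gG by (auto simp: hom_def)
    have "\<sigma> g (\<psi> (\<one>\<^bsub>G\<^esub>, a)) = \<theta> (N #>\<^bsub>G\<^esub> g) (f (N #>\<^bsub>G\<^esub> \<one>\<^bsub>G\<^esub>, a))"
      using gG by (simp add: \<sigma>_def \<psi>f)
    also have "\<dots> = f ((N #>\<^bsub>G\<^esub> g) <#>\<^bsub>G\<^esub> (N #>\<^bsub>G\<^esub> \<one>\<^bsub>G\<^esub>), a)"
      using \<theta>(2)[of "N #>\<^bsub>G\<^esub> g" "f (N #>\<^bsub>G\<^esub> \<one>\<^bsub>G\<^esub>, a)"] \<beta>(2)[of "N #>\<^bsub>G\<^esub> g" "(N #>\<^bsub>G\<^esub> \<one>\<^bsub>G\<^esub>, a)"] Ng N1 a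
      by (simp add: carrQ)
    also have "\<dots> = \<psi> (g, a)" using gG by (simp add: N.rcos_sum \<psi>f)
    finally have \<sigma>\<psi>: "\<sigma> g (\<psi> (\<one>\<^bsub>G\<^esub>, a)) = \<psi> (g, a)" .
    have "mdist U (\<rho> g a) (\<sigma> g a) \<le> mdist U (\<rho> g a) (\<psi> (g, a)) + mdist U (\<psi> (g, a)) (\<sigma> g a)"
      using \<rho>U[of "(g, a)"] gG a \<psi>U Iso_mem[OF \<sigma>g aU aU] by (intro U.triangle) auto
    also have "mdist U (\<rho> g a) (\<psi> (g, a)) = e / 2" using \<psi>(2)[OF I(1)] by (simp add: U.commute)
    also have "mdist U (\<psi> (g, a)) (\<sigma> g a) = mdist U (\<psi> (\<one>\<^bsub>G\<^esub>, a)) a"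
      using Iso_dist[OF \<sigma>g \<psi>U(2) aU] by (simp add: \<sigma>\<psi>)
    also have "\<dots> = e / 2" using \<psi>(2)[OF I(2)] by (simp add: \<rho>_one aU)
    finally show "mdist U (\<rho> g a) (\<sigma> g a) \<le> e" by simp
  qed
qed

theorem theorem1:
  fixes G :: "('g, 'b) monoid_scheme" and U :: "'u metric"
  assumes "residually_finite G" and "urysohn_space U"
  shows "Rep_topology G U closure_of {\<rho> \<in> Rep G U. finite (\<rho> ` carrier G)}
           = topspace (Rep_topology G U)"
proof (rule antisym[OF closure_of_subset_topspace], rule subsetI)
  fix \<rho> assume "\<rho> \<in> topspace (Rep_topology G U)"
  then have \<rho>: "\<rho> \<in> Rep G U" by (simp add: topspace_Rep_topology)
  then have hom: "\<rho> \<in> hom G (Iso U)" by (simp add: Rep_def)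
  show "\<rho> \<in> Rep_topology G U closure_of {\<rho> \<in> Rep G U. finite (\<rho> ` carrier G)}"
  proof (rule in_closure_of_Rep_topology[OF \<rho>])
    fix F A and e :: real
    assume fin: "finite F" "F \<subseteq> carrier G" "finite A" "A \<subseteq> mspace U" and "0 < e"
    then have "0 < e / 2" by simp
    then obtain \<sigma> where \<sigma>: "\<sigma> \<in> Rep G U" "finite (\<sigma> ` carrier G)"
      "\<And>g a. g \<in> F \<Longrightarrow> a \<in> A \<Longrightarrow> mdist U (\<rho> g a) (\<sigma> g a) \<le> e / 2"
      by (rule finite_range_approximation[OF assms hom fin]) blast
    have "mdist U (\<rho> g a) (\<sigma> g a) < e" if "g \<in> F" "a \<in> A" for g a
      using \<sigma>(3)[OF that] \<open>0 < e\<close> by linarith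
    then show "\<exists>\<sigma>\<in>{\<rho> \<in> Rep G U. finite (\<rho> ` carrier G)}. \<forall>g\<in>F. \<forall>a\<in>A. mdist U (\<rho> g a) (\<sigma> g a) < e"
      using \<sigma>(1,2) by blast
  qed blast
qed

end
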